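(* Let $f:\mathbb R\to\mathbb R$ be twice continuously differentiable and suppose there are constants $q\ge 1$ (with $q\le 2$ if $d=3$), $K_1,K_3\in\mathbb R$, $K_2>0$, $L_1,\dots,L_6>0$ such that for all $\xi\in\mathbb R$ and all $\tau\in(0,1)$: $$\xi f(\xi)\le K_1-K_2|\xi|^{q+2},$$ $$[1+\tau|\xi|^{2q}]f'(\xi)-q\tau|\xi|^{2(q-1)}\xi f(\xi)\le K_3(1+\tau|\xi|^{2q})^{3/2},$$ $$|f(\xi)|\le L_1+L_2|\xi|^{q+1},\quad |f'(\xi)|\le L_3+L_4|\xi|^q,\quad |f''(\xi)|\le L_5+L_6|\xi|^{q-1}.$$ Then there exist positive constants $\tau_1<1$ and $T_1$ such that for any $\tau\in(0,\tau_1)$, $\xi\in\mathbb R$, $u,v\in H$ and $w\in\dot H^1$, $$f_\tau'(\xi)+\tau|f_\tau'(\xi)|^2\le K_3+K_3^2\tau,$$ $$\langle F_\tau(u)-F_\tau(v),u-v\rangle+\tau\|F_\tau(u)-F_\tau(v)\|^2\le(K_3+K_3^2\tau)\|u-v\|^2,$$ $$\langle w,F_\tau(w)\rangle_1+\tau\|F_\tau(w)\|_1^2\le T_1+(K_3+K_3^2\tau)\|w\|_1^2.$$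
   Context: $\mathscr O\subset\mathbb R^d$, $d\in\{1,2,3\}$, is a bounded open set with piecewise smooth boundary; $H=L^2(\mathscr O)$ with norm $\|\cdot\|$ and inner product $\langle\cdot,\cdot\rangle$; $\dot H^1=H_0^1(\mathscr O)$. For functions with square-integrable gradient, $\langle u,v\rangle_1=\langle u,v\rangle+\langle\nabla u,\nabla v\rangle$ and $\|u\|_1^2=\langle u,u\rangle_1$. For $\tau\in(0,1)$ the tamed function is $f_\tau(\xi)=f(\xi)(1+\tau|\xi|^{2q})^{-1/2}$, $\xi\in\mathbb R$, and $F_\tau(u)(\xi)=f_\tau(u(\xi))$, $\xi\in\mathscr O$, is its Nemytskii operator. *)

theory Defs
  imports "HOL-Analysis.Analysis"
begin

fun Ck_on :: "nat \<Rightarrow> 'a::euclidean_space set \<Rightarrow> ('a \<Rightarrow> 'b::real_normed_vector) \<Rightarrow> bool" where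
  "Ck_on 0 U f \<longleftrightarrow> continuous_on U f"
| "Ck_on (Suc k) U f \<longleftrightarrow>
     (\<forall>x\<in>U. f differentiable (at x)) \<and>
     (\<forall>i\<in>Basis. Ck_on k U (\<lambda>x. frechet_derivative f (at x) i))"

text \<open>Intended for open \<open>U\<close> only: the derivatives are taken in the full space.\<close>

definition smooth_on :: "'a::euclidean_space set \<Rightarrow> ('a \<Rightarrow> 'b::real_normed_vector) \<Rightarrow> bool" where
  "smooth_on U f \<longleftrightarrow> (\<forall>k. Ck_on k U f)"

text \<open>A smooth parametrised hypersurface patch. The parameter domain \<open>P\<close> is a compact convex
  polytope of dimension \<open>DIM('a) - 1\<close>, placed in a hyperplane of \<open>'a\<close> because there is no type of
  that dimension. As usual for parametrised patches, injectivity and regularity are required only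
  in the (relative) interior of the parameter domain, so that spherical coordinates or the vertex
  of a circular cone are admitted.\<close>

definition smooth_patch :: "'a::euclidean_space set \<Rightarrow> ('a \<Rightarrow> 'a) \<Rightarrow> bool" where
  "smooth_patch P \<phi> \<longleftrightarrow>
     polytope P \<and> aff_dim P = int DIM('a) - 1 \<and>
     (\<exists>U. open U \<and> P \<subseteq> U \<and> smooth_on U \<phi>) \<and>
     inj_on \<phi> (rel_interior P) \<and>
     (\<forall>x\<in>rel_interior P. \<forall>v\<in>span {a - b |a b. a \<in> P \<and> b \<in> P}.
        frechet_derivative \<phi> (at x) v = 0 \<longrightarrow> v = 0)"

text \<open>The boundary is a finite union of smooth patches which meet only along their edges.\<close>

definition piecewise_smooth_boundary :: "'a::euclidean_space set \<Rightarrow> bool" where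
  "piecewise_smooth_boundary \<Omega> \<longleftrightarrow>
     (\<exists>(N::nat) P \<phi>.
        (\<forall>i<N. smooth_patch (P i) (\<phi> i)) \<and>
        (\<forall>i<N. \<forall>j<N. i \<noteq> j \<longrightarrow> \<phi> i ` rel_interior (P i) \<inter> \<phi> j ` P j = {}) \<and>
        frontier \<Omega> = (\<Union>i<N. \<phi> i ` P i))"

text \<open>Elements of \<open>L\<^sup>2\<close> and of the Sobolev spaces are represented by functions on the whole space;
  only their values on \<open>\<Omega>\<close>, up to null sets, matter.\<close>

definition L2_functions :: "'a::euclidean_space set \<Rightarrow> ('a \<Rightarrow> real) set" where
  "L2_functions \<Omega> = {u. u \<in> borel_measurable (lebesgue_on \<Omega>) \<and> integrable (lebesgue_on \<Omega>) (\<lambda>x. (u x)\<^sup>2)}"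

definition L2_inner :: "'a::euclidean_space set \<Rightarrow> ('a \<Rightarrow> real) \<Rightarrow> ('a \<Rightarrow> real) \<Rightarrow> real" where
  "L2_inner \<Omega> u v = (\<integral>x. u x * v x \<partial>lebesgue_on \<Omega>)"

definition L2_norm :: "'a::euclidean_space set \<Rightarrow> ('a \<Rightarrow> real) \<Rightarrow> real" where
  "L2_norm \<Omega> u = sqrt (L2_inner \<Omega> u u)"

definition test_functions :: "'a::euclidean_space set \<Rightarrow> ('a \<Rightarrow> real) set" where
  "test_functions \<Omega> =
     {\<phi>. smooth_on UNIV \<phi> \<and> (\<exists>K. compact K \<and> K \<subseteq> \<Omega> \<and> (\<forall>x. x \<notin> K \<longrightarrow> \<phi> x = 0))}"

definition has_weak_gradient ::
    "'a::euclidean_space set \<Rightarrow> ('a \<Rightarrow> real) \<Rightarrow> ('a \<Rightarrow> 'a) \<Rightarrow> bool" where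
  "has_weak_gradient \<Omega> u G \<longleftrightarrow>
     G \<in> borel_measurable (lebesgue_on \<Omega>) \<and>
     integrable (lebesgue_on \<Omega>) (\<lambda>x. (norm (G x))\<^sup>2) \<and>
     (\<forall>\<phi>\<in>test_functions \<Omega>. \<forall>i\<in>Basis.
        (\<integral>x. u x * frechet_derivative \<phi> (at x) i \<partial>lebesgue_on \<Omega>) =
        - (\<integral>x. (G x \<bullet> i) * \<phi> x \<partial>lebesgue_on \<Omega>))"

definition H1 :: "'a::euclidean_space set \<Rightarrow> ('a \<Rightarrow> real) set" where
  "H1 \<Omega> = {u \<in> L2_functions \<Omega>. \<exists>G. has_weak_gradient \<Omega> u G}"

text \<open>For \<open>u \<in> H1 \<Omega>\<close> the weak gradient is unique up to a null set; outside \<open>H1 \<Omega>\<close> the value is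
  meaningless.\<close>

definition weak_gradient :: "'a::euclidean_space set \<Rightarrow> ('a \<Rightarrow> real) \<Rightarrow> 'a \<Rightarrow> 'a" where
  "weak_gradient \<Omega> u = (SOME G. has_weak_gradient \<Omega> u G)"

definition H1_inner :: "'a::euclidean_space set \<Rightarrow> ('a \<Rightarrow> real) \<Rightarrow> ('a \<Rightarrow> real) \<Rightarrow> real" where
  "H1_inner \<Omega> u v =
     L2_inner \<Omega> u v + (\<integral>x. weak_gradient \<Omega> u x \<bullet> weak_gradient \<Omega> v x \<partial>lebesgue_on \<Omega>)"

definition H1_norm :: "'a::euclidean_space set \<Rightarrow> ('a \<Rightarrow> real) \<Rightarrow> real" where
  "H1_norm \<Omega> u = sqrt (H1_inner \<Omega> u u)"

text \<open>The closure of the test functions in \<open>H1 \<Omega>\<close>.\<close>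

definition H10 :: "'a::euclidean_space set \<Rightarrow> ('a \<Rightarrow> real) set" where
  "H10 \<Omega> = {w \<in> H1 \<Omega>. \<forall>e>0. \<exists>\<phi>\<in>test_functions \<Omega>. H1_norm \<Omega> (\<lambda>x. w x - \<phi> x) < e}"

text \<open>Real power of a nonnegative base with the convention \<open>0\<^sup>0 = 1\<close>, whereas \<open>0 powr 0 = 0\<close>.
  The difference matters for \<open>\<bar>\<xi>\<bar>\<^sup>q\<^sup>-\<^sup>1\<close> at \<open>\<xi> = 0\<close> when \<open>q = 1\<close>.\<close>

definition rpow :: "real \<Rightarrow> real \<Rightarrow> real" where
  "rpow x a = (if a = 0 then 1 else x powr a)"

definition tamed :: "(real \<Rightarrow> real) \<Rightarrow> real \<Rightarrow> real \<Rightarrow> real \<Rightarrow> real" where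
  "tamed f q \<tau> \<xi> = f \<xi> * rpow (1 + \<tau> * rpow \<bar>\<xi>\<bar> (2 * q)) (- 1 / 2)"

definition Nemytskii :: "(real \<Rightarrow> real) \<Rightarrow> ('a \<Rightarrow> real) \<Rightarrow> 'a \<Rightarrow> real" where
  "Nemytskii g u = (\<lambda>x. g (u x))"

end

theory Submission
  imports Defs
begin

text \<open>
  Write \<open>g\<close> for the tamed function and \<open>D = 1 + \<tau>\<bar>\<xi>\<bar>\<^sup>2\<^sup>q\<close>. The quotient rule gives
  \<open>g' = (D f' - q\<tau>\<bar>\<xi>\<bar>\<^sup>2\<^sup>q\<^sup>-\<^sup>2 \<xi> f) / D\<^sup>3\<^sup>/\<^sup>2\<close>, so the one-sided hypothesis on \<open>f\<close> says exactly that
  \<open>g' \<le> K3\<close>, while the growth bounds give \<open>\<bar>g'\<bar> \<le> C / \<surd>\<tau>\<close>: taming trades polynomial growth for a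
  Lipschitz constant of order \<open>\<tau>\<^sup>-\<^sup>1\<^sup>/\<^sup>2\<close>. Since
  \<open>K3 + K3\<^sup>2\<tau> - (m + \<tau>m\<^sup>2) = (K3 - m)(1 + \<tau>(K3 + m))\<close>, every \<open>m\<close> between \<open>- 1 / \<tau> - K3\<close> and \<open>K3\<close> satisfies
  \<open>m + \<tau>m\<^sup>2 \<le> K3 + K3\<^sup>2\<tau>\<close>; and \<open>C / \<surd>\<tau> + \<bar>K3\<bar> \<le> 1 / \<tau>\<close> for small \<open>\<tau>\<close>. This is the first estimate.

  For the second one, the mean value theorem turns \<open>g s - g t\<close> into \<open>m (s - t)\<close> with a value \<open>m\<close> of
  \<open>g'\<close>, so the estimate for \<open>m\<close> times \<open>(s - t)\<^sup>2\<close> holds pointwise and can be integrated.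

  For the third one, the chain rule says that \<open>g \<circ> w\<close> has the weak gradient \<open>g'(w) \<nabla>w\<close>, and the
  gradient part is again the first estimate times \<open>\<bar>\<nabla>w\<bar>\<^sup>2\<close>. The part without derivatives cannot be
  handled by comparing \<open>w\<close> with \<open>0\<close> in the second estimate: as \<open>g 0\<close> need not vanish, this would leave a
  term linear in \<open>w\<close>, for which the constant leaves no room. Here dissipativity helps: with \<open>\<rho> = \<bar>\<xi>\<bar>\<^sup>q / \<surd>D\<close> one has
  \<open>\<xi> g \<le> \<bar>K1\<bar> - K2 \<rho> \<xi>\<^sup>2\<close>, the term \<open>\<tau>g\<^sup>2\<close> costs only half of the gain, and \<open>\<rho>\<close> is large
  as soon as \<open>\<bar>\<xi>\<bar>\<close> is large and \<open>\<tau>\<close> is small (lemma \<open>tamed_dissipative\<close>).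

  The weak gradient in the definition of the norm is a choice among all weak gradients. Both the
  chain rule and the meaning of approximation in the \<open>H\<^sup>1\<close> norm therefore rest on its uniqueness almost
  everywhere, which is the fundamental lemma of the calculus of variations
  (\<open>AE_zero_if_test_integrals_zero\<close>). The chain rule itself (\<open>has_weak_gradient_compose\<close>) is
  integration by parts for a composition with a test function, followed by a limit along test
  functions that converge to \<open>w\<close>.
\<close>

section \<open>Pointwise estimates for the tamed function\<close>

text \<open>
  The case \<open>x = 0\<close> is where \<open>1 < p\<close> is used: the difference quotient there has size \<open>\<bar>h\<bar>\<^sup>p\<^sup>-\<^sup>1\<close>.
\<close>

lemma has_real_derivative_abs_powr:
  fixes p x :: real
  assumes "1 < p"
  shows "((\<lambda>x. \<bar>x\<bar> powr p) has_real_derivative p * \<bar>x\<bar> powr (p - 2) * x) (at x)"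
proof (cases "x = 0")
  case True
  have "((\<lambda>h. \<bar>h\<bar> powr (p - 1)) \<longlongrightarrow> 0) (at (0::real))"
    by (rule tendsto_eq_intros refl | use assms in simp)+
  then have "((\<lambda>h. \<bar>h\<bar> powr p / h) \<longlongrightarrow> 0) (at (0::real))"
    by (rule Lim_null_comparison[rotated])
      (auto simp: eventually_at_filter powr_diff)
  then show ?thesis
    using True by (simp add: DERIV_def)
next
  case False
  have ev: "\<forall>\<^sub>F y in nhds x. sgn y = sgn x"
  proof (cases "x > 0")
    case True
    then have "\<forall>\<^sub>F y in nhds x. y \<in> {0<..}" by (intro eventually_nhds_in_open) auto
    then show ?thesis by eventually_elim (use True in auto)
  next
    case False
    with \<open>x \<noteq> 0\<close> have neg: "x < 0" by simp
    then have "\<forall>\<^sub>F y in nhds x. y \<in> {..<0}" by (intro eventually_nhds_in_open) auto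
    then show ?thesis by eventually_elim (use neg in auto)
  qed
  have pos: "sgn x * x > 0" using False by (simp add: sgn_real_def)
  have *: "((\<lambda>y. (sgn x * y) powr p) has_real_derivative p * (sgn x * x) powr (p - 1) * sgn x) (at x)"
    using DERIV_fun_powr[where g = "\<lambda>y. sgn x * y" and x = x and m = "sgn x" and r = p] pos
    by (auto intro!: derivative_eq_intros)
  have "(sgn x * x) powr (p - 1) * sgn x = \<bar>x\<bar> powr (p - 2) * x"
  proof -
    have "\<bar>x\<bar> powr (p - 1) = \<bar>x\<bar> powr (p - 2) * \<bar>x\<bar>"
      using False powr_add[of "\<bar>x\<bar>" "p - 2" 1] by simp
    moreover have "\<bar>x\<bar> * sgn x = x" "sgn x * x = \<bar>x\<bar>" by (auto simp: abs_mult_sgn abs_sgn mult.commute)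
    ultimately show ?thesis by simp
  qed
  with * have "((\<lambda>y. (sgn x * y) powr p) has_real_derivative p * \<bar>x\<bar> powr (p - 2) * x) (at x)"
    by (simp add: mult.assoc)
  moreover have "\<forall>\<^sub>F y in nhds x. \<bar>y\<bar> powr p = (sgn x * y) powr p"
    using ev by eventually_elim (simp add: abs_sgn mult.commute)
  ultimately show ?thesis
    by (subst DERIV_cong_ev[OF refl _ refl])
qed

text \<open>
  The convention \<open>0\<^sup>0 = 1\<close> is invisible after multiplication by \<open>x\<close>; this makes the case \<open>q = 1\<close>
  below fit the general formulas.
\<close>

lemma rpow_times_self: "rpow \<bar>x\<bar> a * x = \<bar>x\<bar> powr a * x" for x :: real
proof (cases "a = 0")
  case True
  show ?thesis unfolding rpow_def True by (cases "x = 0") auto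
next
  case False
  then show ?thesis unfolding rpow_def by auto
qed

lemma continuous_on_abs_powr_times:
  fixes a :: real
  assumes "0 \<le> a"
  shows "continuous_on UNIV (\<lambda>x. \<bar>x\<bar> powr a * x)"
proof (cases "a = 0")
  case True
  then have eq: "(\<lambda>x. \<bar>x\<bar> powr a * x) = (\<lambda>x. x)" by (auto simp: fun_eq_iff)
  show ?thesis unfolding eq by simp
next
  case False
  with assms show ?thesis by (intro continuous_on_mult continuous_on_powr' continuous_intros) auto
qed

text \<open>
  The derivative of \<open>tamed f q \<tau>\<close> when \<open>f'\<close> is the derivative of \<open>f\<close>, with the numerator and the power
  in the form in which the one-sided bound on \<open>f\<close> controls them.
\<close>

definition tamed_deriv :: "(real \<Rightarrow> real) \<Rightarrow> (real \<Rightarrow> real) \<Rightarrow> real \<Rightarrow> real \<Rightarrow> real \<Rightarrow> real" where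
  "tamed_deriv f f' q \<tau> \<xi> =
     ((1 + \<tau> * rpow \<bar>\<xi>\<bar> (2 * q)) * f' \<xi> - q * \<tau> * rpow \<bar>\<xi>\<bar> (2 * (q - 1)) * \<xi> * f \<xi>)
       / (1 + \<tau> * rpow \<bar>\<xi>\<bar> (2 * q)) powr (3 / 2)"

lemma has_real_derivative_tamed:
  assumes f': "(f has_real_derivative f' \<xi>) (at \<xi>)" and "1 \<le> q" "0 \<le> \<tau>"
  shows "(tamed f q \<tau> has_real_derivative tamed_deriv f f' q \<tau> \<xi>) (at \<xi>)"
proof -
  define D where "D = (\<lambda>\<xi>::real. 1 + \<tau> * \<bar>\<xi>\<bar> powr (2 * q))"
  have D1: "1 \<le> D x" for x using \<open>0 \<le> \<tau>\<close> by (simp add: D_def)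
  have tamed_eq: "tamed f q \<tau> = (\<lambda>x. f x * D x powr (- 1 / 2))"
    using assms by (auto simp: tamed_def rpow_def D_def)
  have D': "(D has_real_derivative 2 * q * \<tau> * \<bar>\<xi>\<bar> powr (2 * q - 2) * \<xi>) (at \<xi>)"
    using DERIV_add[OF DERIV_const[of 1] DERIV_cmult[OF has_real_derivative_abs_powr[of "2 * q" \<xi>], of \<tau>]] assms
    by (simp add: D_def mult_ac)
  have Dpos: "D \<xi> > 0" using D1[of \<xi>] by simp
  have h: "((\<lambda>x. f x * D x powr (- 1 / 2)) has_real_derivative
      f' \<xi> * D \<xi> powr (- 1 / 2) + f \<xi> * ((- 1 / 2) * D \<xi> powr (- 1 / 2 - 1) * (2 * q * \<tau> * \<bar>\<xi>\<bar> powr (2 * q - 2) * \<xi>))) (at \<xi>)"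
    using DERIV_mult[OF f' DERIV_fun_powr[OF D' Dpos, of "- 1 / 2"]] by (simp add: algebra_simps)
  have p1: "D \<xi> powr (- 1 / 2) = D \<xi> / D \<xi> powr (3 / 2)"
    using Dpos powr_diff[of "D \<xi>" 1 "3/2"] by simp
  have p2: "D \<xi> powr (- 1 / 2 - 1) = 1 / D \<xi> powr (3 / 2)"
    using Dpos powr_minus_divide[of "D \<xi>" "3/2"] by simp
  have "f' \<xi> * D \<xi> powr (- 1 / 2) + f \<xi> * ((- 1 / 2) * D \<xi> powr (- 1 / 2 - 1) * (2 * q * \<tau> * \<bar>\<xi>\<bar> powr (2 * q - 2) * \<xi>))
      = (D \<xi> * f' \<xi> - q * \<tau> * (\<bar>\<xi>\<bar> powr (2 * (q - 1)) * \<xi>) * f \<xi>) / D \<xi> powr (3 / 2)"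
    unfolding p1 p2 by (simp add: diff_divide_distrib algebra_simps)
  also have "\<dots> = tamed_deriv f f' q \<tau> \<xi>"
    unfolding tamed_deriv_def rpow_times_self[symmetric] D_def using \<open>1 \<le> q\<close> by (simp add: rpow_def mult.assoc)
  finally show ?thesis using h unfolding tamed_eq by simp
qed

lemma continuous_on_tamed_deriv:
  assumes "continuous_on UNIV f" "continuous_on UNIV f'" "1 \<le> q" "0 \<le> \<tau>"
  shows "continuous_on UNIV (tamed_deriv f f' q \<tau>)"
proof -
  have D: "1 + \<tau> * \<bar>x\<bar> powr (2 * q) > 0" for x :: real
    using mult_nonneg_nonneg[OF \<open>0 \<le> \<tau>\<close> powr_ge_zero, of "\<bar>x\<bar>" "2 * q"] by linarith
  have eq: "tamed_deriv f f' q \<tau> = (\<lambda>x. ((1 + \<tau> * \<bar>x\<bar> powr (2 * q)) * f' x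
      - q * \<tau> * (\<bar>x\<bar> powr (2 * (q - 1)) * x) * f x) / (1 + \<tau> * \<bar>x\<bar> powr (2 * q)) powr (3 / 2))"
  proof
    fix x
    have "rpow \<bar>x\<bar> (2 * q) = \<bar>x\<bar> powr (2 * q)" using \<open>1 \<le> q\<close> by (simp add: rpow_def)
    moreover have "q * \<tau> * rpow \<bar>x\<bar> (2 * (q - 1)) * x * f x = q * \<tau> * (rpow \<bar>x\<bar> (2 * (q - 1)) * x) * f x"
      by (simp only: mult.assoc)
    ultimately show "tamed_deriv f f' q \<tau> x = ((1 + \<tau> * \<bar>x\<bar> powr (2 * q)) * f' x
      - q * \<tau> * (\<bar>x\<bar> powr (2 * (q - 1)) * x) * f x) / (1 + \<tau> * \<bar>x\<bar> powr (2 * q)) powr (3 / 2)"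
      unfolding tamed_deriv_def by (simp only: rpow_times_self)
  qed
  have D': "continuous_on UNIV (\<lambda>x::real. 1 + \<tau> * \<bar>x\<bar> powr (2 * q))"
    using \<open>1 \<le> q\<close>
    by (intro continuous_on_add[OF continuous_on_const] continuous_on_mult[OF continuous_on_const]
        continuous_on_powr' continuous_on_rabs continuous_on_id continuous_on_const) auto
  have X: "continuous_on UNIV (\<lambda>x::real. \<bar>x\<bar> powr (2 * (q - 1)) * x)"
    using \<open>1 \<le> q\<close> by (intro continuous_on_abs_powr_times) simp
  have D0: "\<forall>x\<in>UNIV. (1 + \<tau> * \<bar>x\<bar> powr (2 * q)) powr (3 / 2) \<noteq> (0 :: real)"
  proof
    fix x :: real
    show "(1 + \<tau> * \<bar>x\<bar> powr (2 * q)) powr (3 / 2) \<noteq> 0" using D[of x] by simp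
  qed
  have D3: "continuous_on UNIV (\<lambda>x::real. (1 + \<tau> * \<bar>x\<bar> powr (2 * q)) powr (3 / 2))"
  proof (rule continuous_on_powr'[OF D' continuous_on_const], rule ballI)
    fix x :: real
    show "0 \<le> 1 + \<tau> * \<bar>x\<bar> powr (2 * q) \<and> (1 + \<tau> * \<bar>x\<bar> powr (2 * q) = 0 \<longrightarrow> (0 :: real) < 3 / 2)"
      using D[of x] by simp
  qed
  have "continuous_on UNIV (\<lambda>x. q * \<tau> * (\<bar>x\<bar> powr (2 * (q - 1)) * x) * f x)"
    by (rule continuous_on_mult[OF continuous_on_mult[OF continuous_on_const X] assms(1)])
  then show ?thesis
    unfolding eq
    by (rule continuous_on_divide[OF continuous_on_diff[OF continuous_on_mult[OF D' assms(2)]] D3 D0])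
qed

text \<open>
  Everything is measured in \<open>t = \<surd>\<tau>\<close>, \<open>s = \<bar>\<xi>\<bar>\<^sup>q\<close> and the taming factor \<open>r = \<surd>(1 + t\<^sup>2s\<^sup>2)\<close>. In these
  variables the powers of the taming denominator become integer powers of \<open>r\<close>, and the estimates reduce to
  comparing \<open>r\<close> with \<open>1\<close>, \<open>ts\<close> and \<open>1 + ts\<close>.
\<close>

lemma taming_factorE:
  assumes "1 \<le> q" "0 < \<tau>" "\<tau> < 1"
  obtains r s t where "t = sqrt \<tau>" "s = \<bar>\<xi>\<bar> powr q" "0 < t" "t < 1" "0 \<le> s" "1 \<le> r" "t * s \<le> r" "r \<le> 1 + t * s"
    "r\<^sup>2 = 1 + t\<^sup>2 * s\<^sup>2" "1 + \<tau> * rpow \<bar>\<xi>\<bar> (2 * q) = r\<^sup>2"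
    "(1 + \<tau> * rpow \<bar>\<xi>\<bar> (2 * q)) powr (3 / 2) = r ^ 3" "tamed f q \<tau> \<xi> = f \<xi> / r"
proof -
  define s where "s = \<bar>\<xi>\<bar> powr q"
  define t where "t = sqrt \<tau>"
  define r where "r = sqrt (1 + t\<^sup>2 * s\<^sup>2)"
  have t2: "t\<^sup>2 = \<tau>" using assms by (simp add: t_def)
  have s2: "s\<^sup>2 = \<bar>\<xi>\<bar> powr (2 * q)" by (simp add: s_def power2_eq_square flip: powr_add)
  have t: "0 < t" "t < 1" using assms by (auto simp: t_def)
  have s: "0 \<le> s" by (simp add: s_def)
  have r2: "r\<^sup>2 = 1 + t\<^sup>2 * s\<^sup>2" by (simp add: r_def)
  have r1: "1 \<le> r" by (simp add: r_def)
  have D: "1 + \<tau> * rpow \<bar>\<xi>\<bar> (2 * q) = r\<^sup>2"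
    using assms by (simp add: rpow_def r2 t2 s2)
  have half: "r\<^sup>2 powr a = r powr (2 * a)" for a
    using r1 powr_powr[of r 2 a] by (simp add: powr_numeral)
  have "(r\<^sup>2) powr (3/2) = r ^ 3" using r1 by (simp add: half powr_numeral)
  moreover have "tamed f q \<tau> \<xi> = f \<xi> / r"
    using r1 by (simp add: tamed_def D) (simp add: rpow_def half powr_minus_divide)
  moreover have "t * s \<le> r" by (rule power2_le_imp_le) (use r2 r1 in \<open>auto simp: power_mult_distrib\<close>)
  moreover have "r \<le> 1 + t * s"
    by (rule power2_le_imp_le) (use r2 t s in \<open>auto simp: power2_sum power_mult_distrib\<close>)
  ultimately show ?thesis using that[OF t_def s_def t s r1] r2 D by simp
qed

text \<open>
  With \<open>ts \<le> r\<close>, the term \<open>f'/r\<close> is at most \<open>(L3 + L4 s)/r \<le> (L3 + L4)/t\<close>. In the other term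
  \<open>\<bar>\<xi>\<bar>\<^sup>2\<^sup>q\<^sup>-\<^sup>1\<bar>f\<bar> \<le> L1(1 + s\<^sup>2) + L2 s\<^sup>3\<close>, and \<open>t\<^sup>2(1 + s\<^sup>2)\<close> and \<open>t\<^sup>2s\<^sup>3\<close> are both at most \<open>r\<^sup>3/t\<close>.
\<close>

lemma abs_tamed_deriv_le:
  assumes q: "1 \<le> q" and \<tau>: "0 < \<tau>" "\<tau> < 1"
    and L: "0 \<le> L1" "0 \<le> L2" "0 \<le> L3" "0 \<le> L4"
    and growth0: "\<bar>f \<xi>\<bar> \<le> L1 + L2 * rpow \<bar>\<xi>\<bar> (q + 1)"
    and growth1: "\<bar>f' \<xi>\<bar> \<le> L3 + L4 * rpow \<bar>\<xi>\<bar> q"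
  shows "\<bar>tamed_deriv f f' q \<tau> \<xi>\<bar> \<le> (L3 + L4 + q * (L1 + L2)) / sqrt \<tau>"
proof -
  obtain r s t where t: "t = sqrt \<tau>" and s: "s = \<bar>\<xi>\<bar> powr q" and pos: "0 < t" "t < 1" "0 \<le> s" "1 \<le> r"
    and ts: "t * s \<le> r" and r2: "r\<^sup>2 = 1 + t\<^sup>2 * s\<^sup>2" and D: "1 + \<tau> * rpow \<bar>\<xi>\<bar> (2 * q) = r\<^sup>2"
    and D3: "(1 + \<tau> * rpow \<bar>\<xi>\<bar> (2 * q)) powr (3 / 2) = r ^ 3"
    using taming_factorE[OF q \<tau>] by metis
  have t2: "\<tau> = t\<^sup>2" using \<tau> t by simp
  define X where "X = \<bar>\<xi>\<bar> powr (2 * q - 1)"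
  have X: "\<bar>rpow \<bar>\<xi>\<bar> (2 * (q - 1)) * \<xi>\<bar> = X"
  proof (cases "\<xi> = 0")
    case False
    then have "\<bar>\<xi>\<bar> powr (2 * (q - 1)) * \<bar>\<xi>\<bar> = X"
      using powr_add[of "\<bar>\<xi>\<bar>" "2 * (q - 1)" 1] by (simp add: X_def algebra_simps)
    then show ?thesis using False by (simp add: rpow_times_self abs_mult)
  qed (simp add: X_def)
  have s2: "s\<^sup>2 = \<bar>\<xi>\<bar> powr (2 * q)" by (simp add: s power2_eq_square flip: powr_add)
  have X1: "X \<le> 1 + s\<^sup>2"
  proof (cases "\<bar>\<xi>\<bar> \<le> 1")
    case True
    then have "X \<le> 1" using q by (simp add: X_def powr_le1)
    then show ?thesis by (smt (verit) zero_le_power2)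
  next
    case False
    then have "X \<le> s\<^sup>2" using q unfolding X_def s2 by (intro powr_mono) auto
    then show ?thesis by simp
  qed
  have X3: "X * \<bar>\<xi>\<bar> powr (q + 1) = s ^ 3"
    by (simp add: X_def s power3_eq_cube flip: powr_add)
  have f0: "X * \<bar>f \<xi>\<bar> \<le> L1 * (1 + s\<^sup>2) + L2 * s ^ 3"
  proof -
    have "X * \<bar>f \<xi>\<bar> \<le> X * (L1 + L2 * \<bar>\<xi>\<bar> powr (q + 1))"
      using growth0 q by (intro mult_left_mono) (auto simp: rpow_def X_def)
    also have "\<dots> = L1 * X + L2 * s ^ 3" by (simp flip: X3 add: algebra_simps)
    finally show ?thesis using mult_left_mono[OF X1 L(1)] by simp
  qed
  have f1: "\<bar>f' \<xi>\<bar> \<le> L3 + L4 * s" using growth1 q by (simp add: rpow_def s)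
  have r3: "0 < r ^ 3" using pos by simp
  have a: "\<bar>r\<^sup>2 * f' \<xi>\<bar> \<le> ((L3 + L4) / t) * r ^ 3"
  proof -
    have "L3 \<le> L3 / t * r"
    proof -
      have "L3 * t \<le> L3 * r" using pos L(3) by (intro mult_left_mono) auto
      then show ?thesis using pos by (simp add: field_simps)
    qed
    moreover have "L4 * s \<le> L4 / t * r"
      using mult_left_mono[OF ts L(4)] pos by (simp add: field_simps)
    ultimately have "\<bar>f' \<xi>\<bar> \<le> (L3 + L4) / t * r"
      using f1 by (simp add: add_divide_distrib distrib_right)
    then have "r\<^sup>2 * \<bar>f' \<xi>\<bar> \<le> r\<^sup>2 * ((L3 + L4) / t * r)"
      by (rule mult_left_mono) simp
    then show ?thesis by (simp add: abs_mult power3_eq_cube power2_eq_square mult_ac)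
  qed
  have b: "t\<^sup>2 * (X * \<bar>f \<xi>\<bar>) \<le> (L1 + L2) / t * r ^ 3"
  proof -
    have "t\<^sup>2 * (1 + s\<^sup>2) \<le> r\<^sup>2"
      using pos unfolding r2 by (simp add: distrib_left power_le_one)
    also have "\<dots> \<le> r ^ 3" using pos by (intro power_increasing) auto
    also have "\<dots> \<le> r ^ 3 / t" using pos r3 by (simp add: field_simps)
    finally have 1: "t\<^sup>2 * (1 + s\<^sup>2) \<le> r ^ 3 / t" .
    have "(t * s) ^ 3 \<le> r ^ 3" using ts pos by (intro power_mono) auto
    then have 2: "t\<^sup>2 * s ^ 3 \<le> r ^ 3 / t"
      using pos by (simp add: field_simps power3_eq_cube power2_eq_square)
    have "t\<^sup>2 * (X * \<bar>f \<xi>\<bar>) \<le> t\<^sup>2 * (L1 * (1 + s\<^sup>2) + L2 * s ^ 3)"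
      by (intro mult_left_mono f0) simp
    also have "\<dots> = L1 * (t\<^sup>2 * (1 + s\<^sup>2)) + L2 * (t\<^sup>2 * s ^ 3)" by (simp add: algebra_simps)
    also have "\<dots> \<le> L1 * (r ^ 3 / t) + L2 * (r ^ 3 / t)"
      by (intro add_mono mult_left_mono 1 2 L)
    finally show ?thesis by (simp add: algebra_simps add_divide_distrib)
  qed
  have num: "\<bar>r\<^sup>2 * f' \<xi> - q * \<tau> * rpow \<bar>\<xi>\<bar> (2 * (q - 1)) * \<xi> * f \<xi>\<bar>
      \<le> (L3 + L4 + q * (L1 + L2)) / t * r ^ 3"
  proof -
    have "\<bar>q * \<tau> * rpow \<bar>\<xi>\<bar> (2 * (q - 1)) * \<xi> * f \<xi>\<bar>
        = q * \<tau> * (\<bar>rpow \<bar>\<xi>\<bar> (2 * (q - 1)) * \<xi>\<bar> * \<bar>f \<xi>\<bar>)"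
      using q \<tau> by (simp add: abs_mult)
    also have "\<dots> = q * (t\<^sup>2 * (X * \<bar>f \<xi>\<bar>))" unfolding X t2 by simp
    also have "\<dots> \<le> q * ((L1 + L2) / t * r ^ 3)" using b q by (intro mult_left_mono) auto
    finally have "\<bar>q * \<tau> * rpow \<bar>\<xi>\<bar> (2 * (q - 1)) * \<xi> * f \<xi>\<bar> \<le> q * ((L1 + L2) / t * r ^ 3)" .
    with a have "\<bar>r\<^sup>2 * f' \<xi> - q * \<tau> * rpow \<bar>\<xi>\<bar> (2 * (q - 1)) * \<xi> * f \<xi>\<bar>
        \<le> (L3 + L4) / t * r ^ 3 + q * ((L1 + L2) / t * r ^ 3)" by linarith
    also have "\<dots> = (L3 + L4 + q * (L1 + L2)) / t * r ^ 3"
      by (simp add: algebra_simps add_divide_distrib)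
    finally show ?thesis .
  qed
  show ?thesis
    using num r3 by (simp only: tamed_deriv_def D3, simp add: D abs_divide divide_le_eq flip: t)
qed

text \<open>
  The difference of the two sides is \<open>(K - m)(1 + \<tau>(K + m))\<close>.
\<close>

lemma add_square_le_of_bounds:
  fixes m K \<tau> :: real
  assumes "0 \<le> \<tau>" "m \<le> K" "0 \<le> 1 + \<tau> * (K + m)"
  shows "m + \<tau> * m\<^sup>2 \<le> K + K\<^sup>2 * \<tau>"
proof -
  have "0 \<le> (K - m) * (1 + \<tau> * (K + m))" using assms by (intro mult_nonneg_nonneg) auto
  then show ?thesis by (simp add: algebra_simps power2_eq_square)
qed

text \<open>
  The gain \<open>K2 \<rho> \<xi>\<^sup>2\<close> with \<open>\<rho> = s/r\<close> is split in halves. One half absorbs \<open>\<tau>g\<^sup>2\<close>, whose leading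
  part is \<open>2 L2\<^sup>2 (t\<rho>)\<^sup>2 \<xi>\<^sup>2 \<le> 2 L2\<^sup>2 t \<rho> \<xi>\<^sup>2\<close>. The other half yields \<open>A \<xi>\<^sup>2\<close> for a prescribed \<open>A\<close> once
  \<open>\<bar>\<xi>\<bar> \<ge> 4A/K2 + 1\<close>, since then \<open>s \<ge> 4A/K2\<close> and \<open>Ar \<le> A + Ats \<le> K2 s/2\<close>; for smaller \<open>\<bar>\<xi>\<bar>\<close> the term
  \<open>A \<xi>\<^sup>2\<close> is bounded.
\<close>

lemma tamed_dissipative:
  assumes q: "1 \<le> q" and \<tau>: "0 < \<tau>" "\<tau> < 1" and L: "0 \<le> L1" "0 \<le> L2" and K2: "0 < K2"
    and dissip: "\<xi> * f \<xi> \<le> K1 - K2 * rpow \<bar>\<xi>\<bar> (q + 2)"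
    and growth0: "\<bar>f \<xi>\<bar> \<le> L1 + L2 * rpow \<bar>\<xi>\<bar> (q + 1)"
    and small: "4 * L2\<^sup>2 * sqrt \<tau> \<le> K2" "4 * A * sqrt \<tau> \<le> K2" and A: "0 \<le> A"
  shows "\<xi> * tamed f q \<tau> \<xi> + \<tau> * (tamed f q \<tau> \<xi>)\<^sup>2
    \<le> \<bar>K1\<bar> + 2 * L1\<^sup>2 + A * (4 * A / K2 + 1)\<^sup>2 - A * \<xi>\<^sup>2"
proof -
  obtain r s t where t: "t = sqrt \<tau>" and s: "s = \<bar>\<xi>\<bar> powr q" and pos: "0 < t" "t < 1" "0 \<le> s" "1 \<le> r"
    and ts: "t * s \<le> r" and r1: "r \<le> 1 + t * s" and y: "tamed f q \<tau> \<xi> = f \<xi> / r"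
    using taming_factorE[OF q \<tau>] by metis
  have t2: "\<tau> = t\<^sup>2" using \<tau> t by simp
  define S where "S = 4 * A / K2 + 1"
  define \<rho> where "\<rho> = s / r"
  have \<rho>: "0 \<le> \<rho>" "t * \<rho> \<le> 1" using pos ts by (auto simp: \<rho>_def)
  have pw: "\<bar>\<xi>\<bar> powr (q + 2) = s * \<xi>\<^sup>2" "\<bar>\<xi>\<bar> powr (q + 1) = s * \<bar>\<xi>\<bar>"
    by (simp_all add: s powr_add powr_numeral)
  have 1: "\<xi> * (f \<xi> / r) \<le> \<bar>K1\<bar> - K2 * \<rho> * \<xi>\<^sup>2"
  proof -
    have "\<xi> * f \<xi> / r \<le> (K1 - K2 * (s * \<xi>\<^sup>2)) / r"
      using dissip q pos by (intro divide_right_mono) (auto simp: rpow_def pw)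
    also have "\<dots> = K1 / r - K2 * \<rho> * \<xi>\<^sup>2" by (simp add: \<rho>_def diff_divide_distrib)
    also have "K1 / r \<le> \<bar>K1\<bar>" using pos using mult_left_mono[of 1 r "\<bar>K1\<bar>"] by (simp add: divide_le_eq)
    finally show ?thesis by simp
  qed
  have 2: "t\<^sup>2 * (f \<xi> / r)\<^sup>2 \<le> 2 * L1\<^sup>2 + K2 / 2 * \<rho> * \<xi>\<^sup>2"
  proof -
    have "\<bar>f \<xi>\<bar> / r \<le> (L1 + L2 * (s * \<bar>\<xi>\<bar>)) / r"
      using growth0 q pos by (intro divide_right_mono) (auto simp: rpow_def pw)
    also have "\<dots> \<le> L1 + L2 * \<rho> * \<bar>\<xi>\<bar>"
    proof -
      have "L1 / r \<le> L1" using pos L by (simp add: divide_le_eq mult_le_cancel_left1)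
      then show ?thesis by (simp add: \<rho>_def add_divide_distrib)
    qed
    finally have "\<bar>f \<xi> / r\<bar> \<le> L1 + L2 * \<rho> * \<bar>\<xi>\<bar>" using pos by simp
    then have "(f \<xi> / r)\<^sup>2 \<le> (L1 + L2 * \<rho> * \<bar>\<xi>\<bar>)\<^sup>2"
      by (metis abs_ge_zero power2_abs power_mono)
    also have "\<dots> \<le> 2 * L1\<^sup>2 + 2 * (L2 * \<rho> * \<bar>\<xi>\<bar>)\<^sup>2"
      using sum_squares_bound[of L1 "L2 * \<rho> * \<bar>\<xi>\<bar>"] by (simp add: power2_sum)
    finally have "t\<^sup>2 * (f \<xi> / r)\<^sup>2 \<le> t\<^sup>2 * (2 * L1\<^sup>2 + 2 * (L2 * \<rho> * \<bar>\<xi>\<bar>)\<^sup>2)"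
      by (rule mult_left_mono) simp
    also have "\<dots> = t\<^sup>2 * (2 * L1\<^sup>2) + (2 * L2\<^sup>2 * t) * (t * \<rho>) * \<rho> * \<xi>\<^sup>2"
      by (simp add: algebra_simps power2_eq_square)
    also have "\<dots> \<le> 1 * (2 * L1\<^sup>2) + (K2 / 2) * 1 * \<rho> * \<xi>\<^sup>2"
      using small(1) \<rho> pos K2 t
      by (intro add_mono mult_right_mono mult_mono) (auto simp: power_le_one)
    finally show ?thesis by simp
  qed
  have 3: "A * \<xi>\<^sup>2 \<le> A * S\<^sup>2 + K2 / 2 * \<rho> * \<xi>\<^sup>2"
  proof (cases "\<bar>\<xi>\<bar> \<le> S")
    case True
    then have "\<xi>\<^sup>2 \<le> S\<^sup>2" by (metis abs_ge_zero power2_abs power_mono)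
    then have "A * \<xi>\<^sup>2 \<le> A * S\<^sup>2" by (rule mult_left_mono[OF _ A])
    moreover have "0 \<le> K2 / 2 * \<rho> * \<xi>\<^sup>2" using \<rho> K2 by simp
    ultimately show ?thesis by linarith
  next
    case False
    have S1: "1 \<le> S" using A K2 by (simp add: S_def)
    \<comment> \<open>Since \<open>S \<ge> 1\<close>, the power \<open>s = \<bar>\<xi>\<bar>\<^sup>q\<close> dominates \<open>\<bar>\<xi>\<bar>\<close>, which makes \<open>\<rho>\<close> large.\<close>
    have "\<bar>\<xi>\<bar> powr 1 \<le> s" unfolding s using False S1 q by (intro powr_mono) auto
    then have "S \<le> s" using False by simp
    then have "A \<le> K2 / 4 * s" using K2 mult_left_mono[of S s "K2/4"] by (simp add: S_def algebra_simps)
    moreover have "A * (t * s) \<le> K2 / 4 * s"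
      using mult_right_mono[OF small(2) pos(3)] t by simp
    moreover have "A * r \<le> A * (1 + t * s)" using r1 A by (rule mult_left_mono)
    ultimately have "A * r \<le> K2 / 2 * s" by (simp add: algebra_simps)
    then have "A \<le> K2 / 2 * \<rho>" using pos by (simp add: \<rho>_def field_simps)
    then have "A * \<xi>\<^sup>2 \<le> K2 / 2 * \<rho> * \<xi>\<^sup>2" by (rule mult_right_mono) simp
    moreover have "0 \<le> A * S\<^sup>2" using A by simp
    ultimately show ?thesis by linarith
  qed
  show ?thesis
    using 1 2 3 unfolding y unfolding t2 S_def by linarith
qed

section \<open>Smooth approximations of the indicator of a box\<close>

text \<open>
  Any derivative will do: it need not be presented as the chosen \<open>frechet_derivative\<close>.
\<close>

lemma Ck_on_SucI:
  assumes "\<And>x. (f has_derivative f' x) (at x)" and "\<And>i. i \<in> Basis \<Longrightarrow> Ck_on k UNIV (\<lambda>x. f' x i)"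
  shows "Ck_on (Suc k) UNIV f"
proof -
  have "frechet_derivative f (at x) = f' x" for x
    using frechet_derivative_at[OF assms(1)] by simp
  then show ?thesis using assms by (auto simp: differentiable_def)
qed

lemma Ck_on_Suc_imp_Ck_on: "Ck_on (Suc k) UNIV f \<Longrightarrow> Ck_on k UNIV f"
proof (induction k arbitrary: f)
  case 0
  then show ?case by (auto intro!: differentiable_imp_continuous_on simp: differentiable_on_def)
next
  case (Suc k)
  then show ?case by (metis Ck_on.simps(2))
qed

lemma Ck_on_const: "Ck_on k UNIV (\<lambda>x. c)"
proof (induction k arbitrary: c)
  case (Suc k)
  then show ?case by (intro Ck_on_SucI[where f' = "\<lambda>_ _. 0"]) auto
qed simp

lemma Ck_on_add:
  "Ck_on k UNIV f \<Longrightarrow> Ck_on k UNIV g \<Longrightarrow> Ck_on k UNIV (\<lambda>x. f x + g x)"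
proof (induction k arbitrary: f g)
  case 0
  then show ?case by (simp add: continuous_on_add)
next
  case (Suc k)
  then show ?case
    by (intro Ck_on_SucI[where f' = "\<lambda>x i. frechet_derivative f (at x) i + frechet_derivative g (at x) i"]
        has_derivative_add) (auto simp: frechet_derivative_works)
qed

lemma Ck_on_mult:
  fixes f g :: "'a::euclidean_space \<Rightarrow> real"
  shows "Ck_on k UNIV f \<Longrightarrow> Ck_on k UNIV g \<Longrightarrow> Ck_on k UNIV (\<lambda>x. f x * g x)"
proof (induction k arbitrary: f g)
  case 0
  then show ?case by (simp add: continuous_on_mult)
next
  case (Suc k)
  have "Ck_on k UNIV f" "Ck_on k UNIV g"
    using Suc.prems by (auto simp del: Ck_on.simps intro: Ck_on_Suc_imp_Ck_on)
  with Suc show ?case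
    by (intro Ck_on_SucI[where f' = "\<lambda>x i. f x * frechet_derivative g (at x) i + frechet_derivative f (at x) i * g x"]
        has_derivative_mult) (auto simp: frechet_derivative_works intro!: Ck_on_add)
qed

lemma smooth_on_prod:
  fixes f :: "'i \<Rightarrow> 'a::euclidean_space \<Rightarrow> real"
  shows "(\<And>i. i \<in> I \<Longrightarrow> smooth_on UNIV (f i)) \<Longrightarrow> smooth_on UNIV (\<lambda>x. \<Prod>i\<in>I. f i x)"
  by (induction I rule: infinite_finite_induct) (auto simp: smooth_on_def Ck_on_const Ck_on_mult)

text \<open>
  For \<open>p = 1\<close> this is the classical smooth function \<open>exp (- 1/t)\<close> that vanishes for \<open>t \<le> 0\<close>. Carrying a
  polynomial in \<open>1/t\<close> along makes the family closed under differentiation.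
\<close>

definition flat_exp :: "real poly \<Rightarrow> real \<Rightarrow> real" where
  "flat_exp p t = (if t \<le> 0 then 0 else poly p (1 / t) * exp (- (1 / t)))"

text \<open>
  Exponential decay beats every polynomial, term by term.
\<close>

lemma tendsto_poly_times_exp_minus: "((\<lambda>s. poly p s * exp (- s)) \<longlongrightarrow> 0) (at_top :: real filter)"
proof -
  have "((\<lambda>s. \<Sum>i\<le>degree p. coeff p i * (s ^ i / exp s)) \<longlongrightarrow> (\<Sum>i\<le>degree p. coeff p i * 0)) (at_top :: real filter)"
    by (intro tendsto_sum tendsto_mult tendsto_const tendsto_power_div_exp_0)
  then show ?thesis
    by (simp add: poly_altdef sum_distrib_right exp_minus divide_inverse mult.assoc)
qed

lemma flat_exp_0_right: "(flat_exp p \<longlongrightarrow> 0) (at_right 0)"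
proof -
  have "((\<lambda>t. poly p (inverse t) * exp (- inverse t)) \<longlongrightarrow> 0) (at_right 0)"
    by (rule filterlim_compose[OF tendsto_poly_times_exp_minus filterlim_inverse_at_top_right])
  then show ?thesis
    by (rule Lim_transform_eventually) (auto simp: flat_exp_def eventually_at_filter inverse_eq_divide)
qed

text \<open>
  For \<open>t > 0\<close> this is the product rule, with \<open>p'(1/t)\<close> contributing \<open>- p'(1/t)/t\<^sup>2\<close>. At \<open>0\<close> the
  difference quotient is again a function of the family, namely the one for \<open>X p\<close>, and tends to \<open>0\<close>.
\<close>

lemma has_real_derivative_flat_exp:
  "(flat_exp p has_real_derivative flat_exp ([:0, 0, 1:] * (p - pderiv p)) t) (at t)"
proof -
  consider "t < 0" | "t = 0" | "t > 0" by linarith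
  then show ?thesis
  proof cases
    case 1
    have "\<forall>\<^sub>F s in nhds t. s \<in> {..<0}" using 1 by (intro eventually_nhds_in_open) auto
    then have "\<forall>\<^sub>F s in nhds t. flat_exp p s = 0" by eventually_elim (simp add: flat_exp_def)
    then show ?thesis
      using 1 by (subst DERIV_cong_ev[OF refl _ refl]) (auto simp: flat_exp_def)
  next
    case 2
    have "((\<lambda>h. flat_exp p h / h) \<longlongrightarrow> 0) (at_left 0)"
      by (rule Lim_transform_eventually[OF tendsto_const]) (auto simp: flat_exp_def eventually_at_filter)
    moreover have "((\<lambda>h. flat_exp p h / h) \<longlongrightarrow> 0) (at_right 0)"
      by (rule Lim_transform_eventually[OF flat_exp_0_right[of "[:0, 1:] * p"]])
        (auto simp: flat_exp_def eventually_at_filter)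
    ultimately have "((\<lambda>h. flat_exp p h / h) \<longlongrightarrow> 0) (at 0)"
      by (rule filterlim_split_at_real)
    then show ?thesis using 2 by (simp add: DERIV_def flat_exp_def)
  next
    case 3
    have "\<forall>\<^sub>F s in nhds t. s \<in> {0<..}" using 3 by (intro eventually_nhds_in_open) auto
    then have ev: "\<forall>\<^sub>F s in nhds t. flat_exp p s = poly p (1 / s) * exp (- (1 / s))"
      by eventually_elim (simp add: flat_exp_def)
    have "((\<lambda>s. poly p (1 / s) * exp (- (1 / s))) has_real_derivative
        flat_exp ([:0, 0, 1:] * (p - pderiv p)) t) (at t)"
      using 3 by (auto intro!: derivative_eq_intros poly_DERIV[THEN DERIV_chain2]
          simp: flat_exp_def field_simps power2_eq_square)
    then show ?thesis by (subst DERIV_cong_ev[OF refl ev refl])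
  qed
qed

text \<open>
  The induction runs over all polynomials at once, because each derivative stays in the family.
\<close>

lemma Ck_on_flat_exp_affine: "Ck_on k UNIV (\<lambda>x::'a::euclidean_space. flat_exp p (c * (x \<bullet> e) + d))"
proof (induction k arbitrary: p)
  case 0
  have "continuous_on UNIV (flat_exp p)"
    by (meson DERIV_continuous_on has_field_derivative_at_within has_real_derivative_flat_exp)
  then show ?case
    by (auto intro!: continuous_on_compose2[where f = "\<lambda>x. c * (x \<bullet> e) + d"] continuous_intros)
next
  case (Suc k)
  let ?p' = "[:0, 0, 1:] * (p - pderiv p)"
  have D: "((\<lambda>x. flat_exp p (c * (x \<bullet> e) + d)) has_derivative
      (\<lambda>v. flat_exp ?p' (c * (x \<bullet> e) + d) * (c * (v \<bullet> e)))) (at x)" for x :: 'a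
    by (rule has_derivative_eq_rhs[OF DERIV_compose_FDERIV[OF has_real_derivative_flat_exp]])
      (auto intro!: derivative_eq_intros)
  show ?case
    by (rule Ck_on_SucI[OF D]) (intro Ck_on_mult Ck_on_const Suc.IH)
qed

lemma flat_exp_one_bounds: "0 \<le> flat_exp 1 t" "flat_exp 1 t \<le> 1"
  by (auto simp: flat_exp_def)

lemma flat_exp_one_tendsto: "(flat_exp 1 \<longlongrightarrow> 1) at_top"
proof -
  have "((\<lambda>t. exp (- inverse t)) \<longlongrightarrow> exp (- 0)) (at_top :: real filter)"
    by (intro tendsto_intros tendsto_inverse_0_at_top filterlim_ident)
  then have "((\<lambda>t. exp (- inverse t)) \<longlongrightarrow> 1) (at_top :: real filter)" by simp
  then show ?thesis
    by (rule Lim_transform_eventually)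
      (use eventually_gt_at_top[of 0] in \<open>eventually_elim, simp add: flat_exp_def inverse_eq_divide\<close>)
qed

text \<open>
  The factor \<open>Suc n\<close> drives the bump to \<open>1\<close> inside the box as \<open>n\<close> grows, and the shift by \<open>1\<close> keeps
  its support at distance \<open>1 / Suc n\<close> from the boundary.
\<close>

definition box_bump :: "'a::euclidean_space \<Rightarrow> 'a \<Rightarrow> nat \<Rightarrow> 'a \<Rightarrow> real" where
  "box_bump a b n x =
     (\<Prod>i\<in>Basis. flat_exp 1 (real (Suc n) * (x \<bullet> i - a \<bullet> i) - 1) * flat_exp 1 (real (Suc n) * (b \<bullet> i - x \<bullet> i) - 1))"

lemma smooth_box_bump: "smooth_on UNIV (box_bump a b n)"
proof -
  have 1: "smooth_on UNIV (\<lambda>x. flat_exp 1 (real (Suc n) * (x \<bullet> i - a \<bullet> i) - 1)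
      * flat_exp 1 (real (Suc n) * (b \<bullet> i - x \<bullet> i) - 1))" for i
    using Ck_on_flat_exp_affine[of _ 1 "real (Suc n)" i "- real (Suc n) * (a \<bullet> i) - 1"]
      Ck_on_flat_exp_affine[of _ 1 "- real (Suc n)" i "real (Suc n) * (b \<bullet> i) - 1"]
    unfolding smooth_on_def by (intro allI Ck_on_mult) (simp_all add: algebra_simps)
  show ?thesis
    unfolding box_bump_def[abs_def] by (intro smooth_on_prod 1)
qed

lemma box_bump_nonzero:
  assumes "box_bump a b n x \<noteq> 0"
  shows "x \<in> cbox (a + (1 / real (Suc n)) *\<^sub>R One) (b - (1 / real (Suc n)) *\<^sub>R One)"
proof -
  have "a \<bullet> i + 1 / real (Suc n) \<le> x \<bullet> i \<and> x \<bullet> i \<le> b \<bullet> i - 1 / real (Suc n)" if "i \<in> Basis" for i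
  proof -
    have "flat_exp 1 (real (Suc n) * (x \<bullet> i - a \<bullet> i) - 1) \<noteq> 0" "flat_exp 1 (real (Suc n) * (b \<bullet> i - x \<bullet> i) - 1) \<noteq> 0"
      using assms that by (auto simp: box_bump_def prod_zero_iff simp del: of_nat_Suc)
    then have "1 < real (Suc n) * (x \<bullet> i - a \<bullet> i)" "1 < real (Suc n) * (b \<bullet> i - x \<bullet> i)"
      by (auto simp: flat_exp_def simp del: of_nat_Suc split: if_splits)
    then have "1 / real (Suc n) < x \<bullet> i - a \<bullet> i" "1 / real (Suc n) < b \<bullet> i - x \<bullet> i"
      by (simp_all add: divide_less_eq mult.commute del: of_nat_Suc)
    then show ?thesis by linarith
  qed
  then show ?thesis by (auto simp: mem_box inner_simps simp del: of_nat_Suc)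
qed

lemma shrunken_cbox_subset_box:
  fixes a b :: "'a::euclidean_space"
  assumes "0 < \<epsilon>"
  shows "cbox (a + \<epsilon> *\<^sub>R One) (b - \<epsilon> *\<^sub>R One) \<subseteq> box a b"
proof
  fix x assume x: "x \<in> cbox (a + \<epsilon> *\<^sub>R One) (b - \<epsilon> *\<^sub>R One)"
  have "a \<bullet> i < x \<bullet> i \<and> x \<bullet> i < b \<bullet> i" if "i \<in> Basis" for i
  proof -
    have "a \<bullet> i + \<epsilon> \<le> x \<bullet> i" "x \<bullet> i \<le> b \<bullet> i - \<epsilon>"
      using x that by (auto simp: mem_box inner_simps)
    with assms show ?thesis by linarith
  qed
  then show "x \<in> box a b" by (auto simp: mem_box)
qed

text \<open>
  The shrunken box that carries the bump is a compact subset of the open box.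
\<close>

lemma box_bump_in_test_functions:
  assumes "box a b \<subseteq> \<Omega>"
  shows "box_bump a b n \<in> test_functions \<Omega>"
proof -
  let ?K = "cbox (a + (1 / real (Suc n)) *\<^sub>R One) (b - (1 / real (Suc n)) *\<^sub>R One)"
  have "?K \<subseteq> box a b" by (rule shrunken_cbox_subset_box) simp
  then have "compact ?K \<and> ?K \<subseteq> \<Omega> \<and> (\<forall>x. x \<notin> ?K \<longrightarrow> box_bump a b n x = 0)"
    using box_bump_nonzero[of a b n] assms compact_cbox by (metis subset_trans)
  then show ?thesis
    unfolding test_functions_def using smooth_box_bump by blast
qed

lemma box_bump_bounds: "\<bar>box_bump a b n x\<bar> \<le> 1"
  unfolding box_bump_def abs_prod
  by (intro prod_le_1) (auto simp: abs_mult flat_exp_one_bounds mult_le_one abs_of_nonneg simp del: of_nat_Suc)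

lemma box_bump_tendsto: "(\<lambda>n. box_bump a b n x) \<longlonglongrightarrow> indicator (box a b) x"
proof (cases "x \<in> box a b")
  case True
  have *: "(\<lambda>n. flat_exp 1 (real (Suc n) * c - 1)) \<longlonglongrightarrow> 1" if "0 < c" for c :: real
  proof -
    have "filterlim (\<lambda>n. c * real (Suc n)) at_top sequentially"
      by (rule filterlim_tendsto_pos_mult_at_top[OF tendsto_const that])
        (rule filterlim_compose[OF filterlim_real_sequentially filterlim_Suc])
    then have "filterlim (\<lambda>n. - 1 + c * real (Suc n)) at_top sequentially"
      by (rule filterlim_tendsto_add_at_top[OF tendsto_const])
    then have "filterlim (\<lambda>n. real (Suc n) * c - 1) at_top sequentially"
      by (simp add: mult.commute)
    then show ?thesis by (rule filterlim_compose[OF flat_exp_one_tendsto])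
  qed
  have "(\<lambda>n. box_bump a b n x) \<longlonglongrightarrow> (\<Prod>i\<in>(Basis :: 'a set). 1 * 1)"
    unfolding box_bump_def using True by (intro tendsto_prod tendsto_mult *) (auto simp: mem_box)
  then show ?thesis using True by simp
next
  case False
  have "box_bump a b n x = 0" for n
  proof (rule ccontr)
    assume "box_bump a b n x \<noteq> 0"
    then have "x \<in> cbox (a + (1 / real (Suc n)) *\<^sub>R One) (b - (1 / real (Suc n)) *\<^sub>R One)"
      by (rule box_bump_nonzero)
    with False show False using shrunken_cbox_subset_box[of "1 / real (Suc n)" a b] by auto
  qed
  then show ?thesis using False by simp
qed

section \<open>The fundamental lemma of the calculus of variations\<close>

text \<open>
  The sets over which \<open>f\<close> integrates to \<open>0\<close> form a Dynkin system, and open boxes are an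
  intersection-stable generator of the Borel sets. The integral over the whole space vanishes as the limit
  over growing boxes.
\<close>

lemma AE_zero_if_box_integrals_zero:
  fixes f :: "'a::euclidean_space \<Rightarrow> real"
  assumes f: "integrable lborel f" and box0: "\<And>a b. (LINT x:box a b|lborel. f x) = 0"
  shows "AE x in lborel. f x = 0"
proof (rule sigma_finite_measure.density_zero[OF sigma_finite_lborel f])
  have int: "set_integrable lborel A f" if "A \<in> sets borel" for A
    using f that by (simp add: set_integrable_def integrable_real_mult_indicator mult.commute)
  have UNIV0: "(\<integral>x. f x \<partial>lborel) = 0"
  proof -
    have "(\<lambda>n. \<integral>x. indicator (box (- real n *\<^sub>R One) (real n *\<^sub>R One)) x *\<^sub>R f x \<partial>lborel) \<longlonglongrightarrow> (\<integral>x. f x \<partial>lborel)"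
    proof (rule integral_dominated_convergence[where w = "\<lambda>x. \<bar>f x\<bar>"])
      show "AE x in lborel. (\<lambda>n. indicator (box (- real n *\<^sub>R One) (real n *\<^sub>R One)) x *\<^sub>R f x) \<longlonglongrightarrow> f x"
      proof (rule AE_I2)
        fix x :: 'a
        obtain N :: nat where N: "norm x < real N" using reals_Archimedean2 by blast
        have "\<forall>\<^sub>F n in sequentially. indicator (box (- real n *\<^sub>R One) (real n *\<^sub>R One)) x *\<^sub>R f x = f x"
          using eventually_ge_at_top[of N]
        proof eventually_elim
          case (elim n)
          have "\<bar>x \<bullet> i\<bar> < real n" if "i \<in> Basis" for i
            using Basis_le_norm[OF that, of x] N elim by simp
          then have "x \<in> box (- real n *\<^sub>R One) (real n *\<^sub>R One)"
            by (auto simp: mem_box abs_less_iff) (metis minus_less_iff)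
          then show ?case by simp
        qed
        then show "(\<lambda>n. indicator (box (- real n *\<^sub>R One) (real n *\<^sub>R One)) x *\<^sub>R f x) \<longlonglongrightarrow> f x"
          by (rule tendsto_eventually)
      qed
    qed (use f in \<open>auto simp: indicator_def intro: borel_measurable_integrable\<close>)
    moreover have "(\<integral>x. indicator (box (- real n *\<^sub>R One) (real n *\<^sub>R One)) x *\<^sub>R f x \<partial>lborel) = 0" for n
      using box0 by (simp add: set_lebesgue_integral_def)
    ultimately show ?thesis by (simp add: LIMSEQ_const_iff)
  qed
  fix A :: "'a set" assume "A \<in> sets lborel"
  have "Int_stable (range (\<lambda>(a, b). box a b :: 'a set))"
    by (auto simp: Int_stable_def box_Int_box)
  moreover have "range (\<lambda>(a, b). box a b :: 'a set) \<subseteq> Pow UNIV" by simp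
  moreover have "A \<in> sigma_sets UNIV (range (\<lambda>(a, b). box a b))"
    using \<open>A \<in> sets lborel\<close> by (simp add: borel_eq_box)
  ultimately show "(LINT x:A|lborel. f x) = 0"
  proof (induction rule: sigma_sets_induct_disjoint)
    case (basic A)
    then show ?case using box0 by auto
  next
    case empty
    show ?case by (simp add: set_lebesgue_integral_def)
  next
    case (compl A)
    then have [measurable]: "A \<in> sets borel" by (simp add: borel_eq_box)
    have "(LINT x:A \<union> (UNIV - A)|lborel. f x) = (LINT x:A|lborel. f x) + (LINT x:UNIV - A|lborel. f x)"
      by (rule set_integral_Un) (auto intro!: int)
    then show ?case using compl UNIV0 by (simp add: set_lebesgue_integral_def)
  next
    case (union F)
    then have [measurable]: "\<And>i. F i \<in> sets borel" by (simp add: borel_eq_box subset_eq)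
    have "(LINT x:(\<Union>i. F i)|lborel. f x) = (\<Sum>i. (LINT x:F i|lborel. f x))"
      using union(1) by (intro lebesgue_integral_countable_add int) (auto simp: disjoint_family_on_def)
    then show ?case using union by simp
  qed
qed

text \<open>
  Letting the bumps tend to the indicator of a box, the integral of \<open>g\<close> over every box inside
  \<open>\<Omega>\<close> vanishes. A fixed box inside \<open>\<Omega>\<close> meets any other box in a box, so \<open>g\<close> vanishes almost
  everywhere on it, and countably many boxes cover \<open>\<Omega>\<close>. A Borel version \<open>G\<close> of \<open>g\<close> mediates between the
  Lebesgue measure of the statement and the Borel sets generated by boxes.
\<close>

lemma AE_zero_if_test_integrals_zero:
  fixes g :: "'a::euclidean_space \<Rightarrow> real"
  assumes \<Omega>: "open \<Omega>" and g: "integrable (lebesgue_on \<Omega>) g"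
    and zero: "\<And>\<psi>. \<psi> \<in> test_functions \<Omega> \<Longrightarrow> (\<integral>x. g x * \<psi> x \<partial>lebesgue_on \<Omega>) = 0"
  shows "AE x in lebesgue_on \<Omega>. g x = 0"
proof -
  have \<Omega>_sets: "\<Omega> \<in> sets lebesgue" using \<Omega> by simp
  then have \<Omega>_sets': "\<Omega> \<inter> space lebesgue \<in> sets lebesgue" by simp
  have I: "integrable lebesgue (\<lambda>x. indicator \<Omega> x * g x)"
    using g by (simp add: integrable_restrict_space[OF \<Omega>_sets'])
  obtain G where G: "G \<in> borel_measurable lborel" "AE x in lborel. indicator \<Omega> x * g x = G x"
    using completion_ex_borel_measurable_real[OF borel_measurable_integrable[OF I]] by blast
  have G_leb: "AE x in lebesgue. indicator \<Omega> x * g x = G x"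
    by (rule AE_completion[OF G(2)])
  have G_borel [measurable]: "G \<in> borel_measurable borel" using G(1) by simp
  have G_meas: "G \<in> borel_measurable lebesgue" using G(1) by (rule measurable_completion)
  have G_int: "integrable lborel G"
    using integrable_cong_AE_imp[OF I G_meas] G_leb integrable_completion[OF G(1)] by (auto simp: eq_commute)
  have bump0: "(\<integral>x. box_bump a b n x * G x \<partial>lborel) = 0" if "box a b \<subseteq> \<Omega>" for a b n
  proof -
    have "continuous_on UNIV (box_bump a b n)"
      using smooth_box_bump[of a b n] unfolding smooth_on_def by (metis Ck_on.simps(1))
    then have [measurable]: "box_bump a b n \<in> borel_measurable borel"
      by (rule borel_measurable_continuous_onI)
    have m: "(\<lambda>x. box_bump a b n x * G x) \<in> borel_measurable lborel" by measurable
    have "(\<integral>x. box_bump a b n x * G x \<partial>lborel) = (\<integral>x. box_bump a b n x * G x \<partial>lebesgue)"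
      by (rule integral_completion[OF m, symmetric])
    also have "\<dots> = (\<integral>x. indicator \<Omega> x *\<^sub>R (g x * box_bump a b n x) \<partial>lebesgue)"
    proof (rule integral_cong_AE)
      show "(\<lambda>x. box_bump a b n x * G x) \<in> borel_measurable lebesgue" using m by (rule measurable_completion)
      have "box_bump a b n \<in> borel_measurable lebesgue" by (rule measurable_completion) simp
      from borel_measurable_times[OF borel_measurable_integrable[OF I] this]
      show "(\<lambda>x. indicator \<Omega> x *\<^sub>R (g x * box_bump a b n x)) \<in> borel_measurable lebesgue"
        by (simp add: mult.assoc)
      show "AE x in lebesgue. box_bump a b n x * G x = indicator \<Omega> x *\<^sub>R (g x * box_bump a b n x)"
        using G_leb by eventually_elim (simp add: mult_ac flip: mult.assoc)
    qed
    also have "\<dots> = (\<integral>x. g x * box_bump a b n x \<partial>lebesgue_on \<Omega>)"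
      by (rule integral_restrict_space[OF \<Omega>_sets', symmetric])
    also have "\<dots> = 0" by (rule zero[OF box_bump_in_test_functions[OF that]])
    finally show ?thesis .
  qed
  have box0: "(LINT x:box a b|lborel. G x) = 0" if "box a b \<subseteq> \<Omega>" for a b
  proof -
    have [measurable]: "box_bump a b n \<in> borel_measurable borel" for n
      using smooth_box_bump[of a b n] unfolding smooth_on_def
      by (metis Ck_on.simps(1) borel_measurable_continuous_onI)
    have "(\<lambda>n. \<integral>x. box_bump a b n x * G x \<partial>lborel) \<longlonglongrightarrow> (\<integral>x. indicator (box a b) x * G x \<partial>lborel)"
    proof (rule integral_dominated_convergence[where w = "\<lambda>x. \<bar>G x\<bar>"])
      show "integrable lborel (\<lambda>x. \<bar>G x\<bar>)" using G_int by simp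
      show "AE x in lborel. (\<lambda>n. box_bump a b n x * G x) \<longlonglongrightarrow> indicator (box a b) x * G x"
        by (intro AE_I2 tendsto_mult box_bump_tendsto tendsto_const)
      show "AE x in lborel. norm (box_bump a b n x * G x) \<le> \<bar>G x\<bar>" for n
        using box_bump_bounds[of a b n] by (intro AE_I2) (simp add: abs_mult mult_left_le_one_le)
    qed measurable
    then show ?thesis
      using bump0[OF that] by (simp add: LIMSEQ_const_iff set_lebesgue_integral_def)
  qed
  have AE_box: "AE x in lborel. x \<in> box a b \<longrightarrow> G x = 0" if "box a b \<subseteq> \<Omega>" for a b
  proof -
    have "AE x in lborel. indicator (box a b) x * G x = 0"
    proof (rule AE_zero_if_box_integrals_zero)
      show "integrable lborel (\<lambda>x. indicator (box a b) x * G x)"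
        using G_int by (simp add: integrable_real_mult_indicator mult.commute)
      fix c d :: 'a
      obtain e f where ef: "box c d \<inter> box a b = box e f" by (auto simp: box_Int_box)
      have "(LINT x:box c d|lborel. indicator (box a b) x * G x) = (LINT x:box e f|lborel. G x)"
        unfolding set_lebesgue_integral_def ef[symmetric] indicator_inter_arith by (simp add: mult.assoc)
      also have "\<dots> = 0" using ef that by (intro box0) auto
      finally show "(LINT x:box c d|lborel. indicator (box a b) x * G x) = 0" .
    qed
    then show ?thesis by eventually_elim (auto simp: indicator_def)
  qed
  obtain \<D> where \<D>: "countable \<D>" "\<D> \<subseteq> Pow \<Omega>" "\<And>X. X \<in> \<D> \<Longrightarrow> \<exists>a b. X = box a b" "\<Union>\<D> = \<Omega>"
    using open_countable_Union_open_box[OF \<Omega>] by metis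
  have "AE x in lborel. \<forall>X\<in>\<D>. x \<in> X \<longrightarrow> G x = 0"
  proof (subst AE_ball_countable[OF \<D>(1)], rule ballI)
    fix X assume "X \<in> \<D>"
    then obtain a b where "X = box a b" "X \<subseteq> \<Omega>" using \<D> by blast
    then show "AE x in lborel. x \<in> X \<longrightarrow> G x = 0" using AE_box by simp
  qed
  then have "AE x in lborel. x \<in> \<Omega> \<longrightarrow> G x = 0"
    by eventually_elim (use \<D>(4) in blast)
  from AE_completion[OF this] G_leb have "AE x in lebesgue. x \<in> \<Omega> \<longrightarrow> g x = 0"
    by eventually_elim (auto simp: indicator_def)
  then show ?thesis by (simp add: AE_restrict_space_iff[OF \<Omega>_sets'])
qed

section \<open>Integration by parts against test functions\<close>

lemma integrable_lborel_compact_support: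
  fixes F :: "'a::euclidean_space \<Rightarrow> real"
  assumes "continuous_on UNIV F" "compact K" "\<And>x. x \<notin> K \<Longrightarrow> F x = 0"
  shows "integrable lborel F"
proof -
  have "integrable lborel (\<lambda>x. indicator K x *\<^sub>R F x)"
    using assms continuous_on_subset by (intro borel_integrable_compact) blast+
  moreover have "(\<lambda>x. indicator K x *\<^sub>R F x) = F" using assms(3) by (auto simp: fun_eq_iff indicator_def)
  ultimately show ?thesis by simp
qed

lemma integral_lebesgue_on_compact_support:
  fixes F :: "'a::euclidean_space \<Rightarrow> real"
  assumes F: "continuous_on UNIV F" "compact K" "\<And>x. x \<notin> K \<Longrightarrow> F x = 0" and K: "K \<subseteq> \<Omega>" and \<Omega>: "open \<Omega>"
  shows "integrable (lebesgue_on \<Omega>) F" "(\<integral>x. F x \<partial>lebesgue_on \<Omega>) = (\<integral>x. F x \<partial>lborel)"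
proof -
  have \<Omega>': "\<Omega> \<inter> space lebesgue \<in> sets lebesgue" using \<Omega> by simp
  have eq: "(\<lambda>x. indicator \<Omega> x *\<^sub>R F x) = F" using F(3) K by (auto simp: fun_eq_iff indicator_def)
  have F_meas: "F \<in> borel_measurable lborel" using F(1) borel_measurable_continuous_onI by auto
  show "integrable (lebesgue_on \<Omega>) F"
    unfolding integrable_restrict_space[OF \<Omega>'] eq integrable_completion[OF F_meas]
    by (rule integrable_lborel_compact_support[OF F])
  show "(\<integral>x. F x \<partial>lebesgue_on \<Omega>) = (\<integral>x. F x \<partial>lborel)"
    unfolding integral_restrict_space[OF \<Omega>'] eq by (rule integral_completion[OF F_meas])
qed

lemma integral_lborel_translate:
  fixes F :: "'a::euclidean_space \<Rightarrow> real"
  assumes "F \<in> borel_measurable borel"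
  shows "(\<integral>x. F (x + c) \<partial>lborel) = (\<integral>x. F x \<partial>lborel)"
proof -
  have "(\<integral>x. F x \<partial>lborel) = (\<integral>x. F x \<partial>distr lborel borel ((+) c))"
    by (simp add: lborel_distr_plus)
  also have "\<dots> = (\<integral>x. F (c + x) \<partial>lborel)"
    by (rule integral_distr) (use assms in auto)
  finally show ?thesis by (simp add: add.commute)
qed

lemma integrable_lborel_translate:
  fixes F :: "'a::euclidean_space \<Rightarrow> real"
  assumes "integrable lborel F"
  shows "integrable lborel (\<lambda>x. F (x + c))"
proof -
  have "integrable (distr lborel borel ((+) c)) F"
    using assms by (simp add: lborel_distr_plus)
  then have "integrable lborel (\<lambda>x. F (c + x))"
    by (subst (asm) integrable_distr_eq) (use assms in auto)
  then show ?thesis by (simp add: add.commute)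
qed

text \<open>
  By translation invariance the integral of \<open>(F(x + he) - F x)/h\<close> is \<open>0\<close> for every \<open>h\<close>. As \<open>h\<close> tends
  to \<open>0\<close> the quotients tend to \<open>D\<close>, dominated by a bound of \<open>D\<close> on a large ball.
\<close>

lemma integral_directional_derivative_eq_0:
  fixes F D :: "'a::euclidean_space \<Rightarrow> real"
  assumes der: "\<And>x. ((\<lambda>t. F (x + t *\<^sub>R e)) has_real_derivative D x) (at 0)"
    and F: "continuous_on UNIV F" and D: "continuous_on UNIV D"
    and K: "compact K" "\<And>x. x \<notin> K \<Longrightarrow> F x = 0"
  shows "(\<integral>x. D x \<partial>lborel) = 0"
proof -
  have D0: "D x = 0" if "x \<notin> K" for x
  proof -
    have "((\<lambda>t. x + t *\<^sub>R e) \<longlongrightarrow> x + 0 *\<^sub>R e) (at 0)" by (intro tendsto_intros)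
    then have "\<forall>\<^sub>F t in at 0. x + t *\<^sub>R e \<in> - K"
      using that K(1) by (intro topological_tendstoD) (auto intro: compact_imp_closed)
    then have "\<forall>\<^sub>F t in nhds 0. F (x + t *\<^sub>R e) = 0"
      using that K(2) by (auto simp: eventually_nhds_conv_at elim: eventually_mono)
    then have "((\<lambda>t. F (x + t *\<^sub>R e)) has_real_derivative 0) (at 0)"
      by (subst DERIV_cong_ev[OF refl _ refl]) auto
    then show ?thesis using der DERIV_unique by blast
  qed
  obtain B where B: "\<And>x. \<bar>D x\<bar> \<le> B"
  proof -
    have "compact (D ` K)" using D K(1) continuous_on_subset by (blast intro: compact_continuous_image)
    then obtain B where "\<forall>y\<in>D ` K. norm y \<le> B" using compact_imp_bounded bounded_iff by metis
    then have "\<bar>D x\<bar> \<le> max B 0" for x by (cases "x \<in> K") (auto simp: D0 le_max_iff_disj)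
    then show ?thesis using that by blast
  qed
  \<comment> \<open>A ball that contains the supports of all difference quotients with \<open>h \<le> 1\<close>.\<close>
  obtain R where R: "\<And>x. x \<in> K \<Longrightarrow> norm x \<le> R"
    using K(1) compact_imp_bounded bounded_iff by metis
  define h where "h = (\<lambda>n. 1 / real (Suc n))"
  define Q where "Q = (\<lambda>n x. (F (x + h n *\<^sub>R e) - F x) / h n)"
  have h: "0 < h n" "h n \<le> 1" for n by (auto simp: h_def)
  have h0: "h \<longlonglongrightarrow> 0" unfolding h_def by (rule lim_1_over_n[THEN LIMSEQ_Suc])
  have h_at: "filterlim h (at 0) sequentially"
    unfolding filterlim_at using h0 h by (auto simp: less_imp_neq[THEN not_sym])
  have F_meas [measurable]: "F \<in> borel_measurable borel" and D_meas [measurable]: "D \<in> borel_measurable borel"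
    using F D by (auto intro: borel_measurable_continuous_onI)
  have F_int: "integrable lborel F" by (rule integrable_lborel_compact_support[OF F K])
  have Q_bound: "\<bar>Q n x\<bar> \<le> B * indicator (cball 0 (R + norm e)) x" for n x
  proof (cases "x \<in> cball 0 (R + norm e)")
    case True
    have "((\<lambda>t. F (x + t *\<^sub>R e)) has_real_derivative D (x + t *\<^sub>R e)) (at t)" for t
    proof -
      have "((\<lambda>s. F (x + (s + t) *\<^sub>R e)) has_real_derivative D (x + t *\<^sub>R e)) (at 0)"
        using der[of "x + t *\<^sub>R e"] by (simp add: algebra_simps)
      then show ?thesis using DERIV_shift[of "\<lambda>s. F (x + s *\<^sub>R e)" "D (x + t *\<^sub>R e)" 0 t] by simp
    qed
    then obtain z where "F (x + h n *\<^sub>R e) - F (x + 0 *\<^sub>R e) = (h n - 0) * D (x + z *\<^sub>R e)"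
      using MVT2[OF h(1)[of n], of "\<lambda>t. F (x + t *\<^sub>R e)" "\<lambda>t. D (x + t *\<^sub>R e)"] by blast
    then have "Q n x = D (x + z *\<^sub>R e)" using h(1)[of n] by (simp add: Q_def)
    then show ?thesis using B True by simp
  next
    case False
    have "norm x \<le> norm (x + h n *\<^sub>R e) + norm e"
    proof -
      have "norm x \<le> norm (x + h n *\<^sub>R e) + norm (h n *\<^sub>R e)"
        by (metis add_diff_cancel_right' norm_triangle_ineq4)
      moreover have "norm (h n *\<^sub>R e) \<le> norm e" using h[of n] by (simp add: mult_left_le_one_le)
      ultimately show ?thesis by linarith
    qed
    with False have "x + h n *\<^sub>R e \<notin> K" "x \<notin> K" using R norm_ge_zero[of e] by fastforce+
    then show ?thesis using False K(2) by (simp add: Q_def)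
  qed
  have "(\<lambda>n. \<integral>x. Q n x \<partial>lborel) \<longlonglongrightarrow> (\<integral>x. D x \<partial>lborel)"
  proof (rule integral_dominated_convergence[where w = "\<lambda>x. B * indicator (cball 0 (R + norm e)) x"])
    show "integrable lborel (\<lambda>x::'a. B * indicator (cball 0 (R + norm e)) x)"
      by (intro integrable_mult_right integrable_real_indicator emeasure_bounded_finite) auto
    show "AE x in lborel. (\<lambda>n. Q n x) \<longlonglongrightarrow> D x"
    proof (rule AE_I2)
      fix x
      have "((\<lambda>t. (F (x + t *\<^sub>R e) - F x) / t) \<longlongrightarrow> D x) (at 0)"
        using der[of x] by (simp add: DERIV_def)
      from filterlim_compose[OF this h_at] show "(\<lambda>n. Q n x) \<longlonglongrightarrow> D x" by (simp add: Q_def)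
    qed
    show "AE x in lborel. norm (Q n x) \<le> B * indicator (cball 0 (R + norm e)) x" for n
      using Q_bound by simp
    show "D \<in> borel_measurable lborel" by simp
    show "Q n \<in> borel_measurable lborel" for n unfolding Q_def by measurable
  qed
  moreover have "(\<integral>x. Q n x \<partial>lborel) = 0" for n
    unfolding Q_def
    by (simp add: integrable_lborel_translate[OF F_int] F_int integral_lborel_translate[OF F_meas])
  ultimately show ?thesis by (simp add: LIMSEQ_const_iff)
qed

definition gradient :: "('a::euclidean_space \<Rightarrow> real) \<Rightarrow> 'a \<Rightarrow> 'a" where
  "gradient \<phi> x = (\<Sum>i\<in>Basis. frechet_derivative \<phi> (at x) i *\<^sub>R i)"

lemma gradient_inner: "i \<in> Basis \<Longrightarrow> gradient \<phi> x \<bullet> i = frechet_derivative \<phi> (at x) i"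
  by (simp add: gradient_def inner_sum_left_Basis)

lemma test_function_has_derivative:
  assumes "\<phi> \<in> test_functions \<Omega>"
  shows "(\<phi> has_derivative frechet_derivative \<phi> (at x)) (at x)"
proof -
  have "Ck_on (Suc 0) UNIV \<phi>" using assms unfolding test_functions_def smooth_on_def by blast
  then show ?thesis by (simp add: frechet_derivative_works)
qed

lemma test_function_continuous:
  assumes "\<phi> \<in> test_functions \<Omega>"
  shows "continuous_on UNIV \<phi>" "continuous_on UNIV (gradient \<phi>)"
proof -
  have C0: "Ck_on 0 UNIV \<phi>" and C1: "Ck_on (Suc 0) UNIV \<phi>"
    using assms unfolding test_functions_def smooth_on_def by blast+
  show "continuous_on UNIV \<phi>" using C0 by simp
  have "continuous_on UNIV (\<lambda>x. frechet_derivative \<phi> (at x) i)" if "i \<in> Basis" for i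
    using C1 that by simp
  then show "continuous_on UNIV (gradient \<phi>)"
    unfolding gradient_def[abs_def] by (intro continuous_intros)
qed

lemma test_function_support:
  assumes "\<phi> \<in> test_functions \<Omega>"
  shows "\<exists>K. compact K \<and> K \<subseteq> \<Omega> \<and> (\<forall>x. x \<notin> K \<longrightarrow> \<phi> x = 0 \<and> gradient \<phi> x = 0)"
proof -
  obtain K where K: "compact K" "K \<subseteq> \<Omega>" "\<And>x. x \<notin> K \<Longrightarrow> \<phi> x = 0"
    using assms by (auto simp: test_functions_def)
  have "gradient \<phi> x = 0" if "x \<notin> K" for x
  proof -
    have "open (- K)" using K(1) by (simp add: compact_imp_closed open_Compl)
    have "(\<phi> has_derivative (\<lambda>_. 0)) (at x)"
      by (rule has_derivative_transform_within_open[OF has_derivative_const \<open>open (- K)\<close>]) (use that K(3) in auto)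
    then have "frechet_derivative \<phi> (at x) = (\<lambda>_. 0)" by (metis frechet_derivative_at)
    then show ?thesis by (simp add: gradient_def)
  qed
  with K show ?thesis by auto
qed

lemma test_function_line_derivative:
  assumes "\<phi> \<in> test_functions \<Omega>"
  shows "((\<lambda>t. \<phi> (x + t *\<^sub>R v)) has_real_derivative frechet_derivative \<phi> (at x) v) (at 0)"
proof -
  note der = test_function_has_derivative[OF assms, of x]
  have "((\<lambda>t. x + t *\<^sub>R v) has_derivative (\<lambda>t. t *\<^sub>R v)) (at 0)"
    by (auto intro!: derivative_eq_intros)
  from has_derivative_compose[OF this, of \<phi> "frechet_derivative \<phi> (at x)"] der
  have "((\<lambda>t. \<phi> (x + t *\<^sub>R v)) has_derivative (\<lambda>t. frechet_derivative \<phi> (at x) (t *\<^sub>R v))) (at 0)" by simp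
  moreover have "frechet_derivative \<phi> (at x) (t *\<^sub>R v) = frechet_derivative \<phi> (at x) v * t" for t
    using has_derivative_linear[OF der] by (simp add: linear_scale mult.commute)
  ultimately show ?thesis by (simp add: has_field_derivative_def)
qed

text \<open>
  The product of \<open>g \<circ> \<phi>\<close> and \<open>\<psi>\<close> is a continuously differentiable function with compact support in
  \<open>\<Omega>\<close>, so the integral of its derivative vanishes. Only \<open>\<psi>\<close> provides the compact support, hence
  \<open>g 0\<close> may be nonzero.
\<close>

lemma integral_by_parts_test:
  assumes \<Omega>: "open \<Omega>" and \<phi>: "\<phi> \<in> test_functions \<Omega>" and \<psi>: "\<psi> \<in> test_functions \<Omega>" and i: "i \<in> Basis"
    and g: "\<And>t. (g has_real_derivative g' t) (at t)" and g': "continuous_on UNIV g'"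
  shows "(\<integral>x. g (\<phi> x) * frechet_derivative \<psi> (at x) i \<partial>lebesgue_on \<Omega>)
    = - (\<integral>x. ((g' (\<phi> x) *\<^sub>R gradient \<phi> x) \<bullet> i) * \<psi> x \<partial>lebesgue_on \<Omega>)"
proof -
  obtain K where K: "compact K" "K \<subseteq> \<Omega>" "\<And>x. x \<notin> K \<Longrightarrow> \<psi> x = 0" "\<And>x. x \<notin> K \<Longrightarrow> gradient \<psi> x = 0"
    using test_function_support[OF \<psi>] by blast
  note \<phi>_cont = test_function_continuous[OF \<phi>] and \<psi>_cont = test_function_continuous[OF \<psi>]
  have g_cont: "continuous_on UNIV g"
    using g by (meson DERIV_continuous_on has_field_derivative_at_within)
  have g\<phi>: "continuous_on UNIV (\<lambda>x. g (\<phi> x))" "continuous_on UNIV (\<lambda>x. g' (\<phi> x))"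
    using continuous_on_compose2[OF g_cont \<phi>_cont(1)] continuous_on_compose2[OF g' \<phi>_cont(1)] by auto
  define A where "A = (\<lambda>x. g (\<phi> x) * (gradient \<psi> x \<bullet> i))"
  define B where "B = (\<lambda>x. ((g' (\<phi> x) *\<^sub>R gradient \<phi> x) \<bullet> i) * \<psi> x)"
  have A: "continuous_on UNIV A" "\<And>x. x \<notin> K \<Longrightarrow> A x = 0"
    unfolding A_def using K by (auto intro!: continuous_intros g\<phi> \<psi>_cont)
  have B: "continuous_on UNIV B" "\<And>x. x \<notin> K \<Longrightarrow> B x = 0"
    unfolding B_def using K by (auto intro!: continuous_intros g\<phi> \<phi>_cont \<psi>_cont)
  have "(\<integral>x. A x + B x \<partial>lborel) = 0"
  proof (rule integral_directional_derivative_eq_0[where F = "\<lambda>x. g (\<phi> x) * \<psi> x" and e = i and K = K])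
    fix x
    have "((\<lambda>t. g (\<phi> (x + t *\<^sub>R i))) has_real_derivative g' (\<phi> x) * frechet_derivative \<phi> (at x) i) (at 0)"
      using DERIV_chain2[of g "g' (\<phi> x)" "\<lambda>t. \<phi> (x + t *\<^sub>R i)" 0, OF _ test_function_line_derivative[OF \<phi>]] g by simp
    from DERIV_mult[OF this test_function_line_derivative[OF \<psi>]]
    show "((\<lambda>t. g (\<phi> (x + t *\<^sub>R i)) * \<psi> (x + t *\<^sub>R i)) has_real_derivative A x + B x) (at 0)"
      using i by (simp add: A_def B_def gradient_inner algebra_simps)
  next
    show "continuous_on UNIV (\<lambda>x. g (\<phi> x) * \<psi> x)" by (intro continuous_intros g\<phi> \<psi>_cont)
    show "continuous_on UNIV (\<lambda>x. A x + B x)" by (intro continuous_intros A B)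
  qed (use K in auto)
  moreover have "(\<integral>x. A x + B x \<partial>lborel) = (\<integral>x. A x \<partial>lborel) + (\<integral>x. B x \<partial>lborel)"
    using integrable_lborel_compact_support[OF A(1) K(1) A(2)] integrable_lborel_compact_support[OF B(1) K(1) B(2)]
    by simp
  ultimately have "(\<integral>x. A x \<partial>lebesgue_on \<Omega>) = - (\<integral>x. B x \<partial>lebesgue_on \<Omega>)"
    using integral_lebesgue_on_compact_support(2)[OF A(1) K(1) A(2) K(2) \<Omega>]
      integral_lebesgue_on_compact_support(2)[OF B(1) K(1) B(2) K(2) \<Omega>] by simp
  then show ?thesis using i by (simp add: A_def B_def gradient_inner)
qed

section \<open>Square integrable functions and weak gradients\<close>

lemma borel_imp_measurable_lebesgue_on:
  assumes "f \<in> borel_measurable borel"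
  shows "f \<in> borel_measurable (lebesgue_on \<Omega>)"
proof -
  have "f \<in> borel_measurable lborel" using assms by simp
  then show ?thesis by (intro measurable_restrict_space1 measurable_completion)
qed

lemma finite_measure_lebesgue_on_bounded_open:
  "open \<Omega> \<Longrightarrow> bounded \<Omega> \<Longrightarrow> finite_measure (lebesgue_on \<Omega>)"
  by (intro finite_measure_lebesgue_on lmeasurable_open)

lemma integrable_mult_bounded:
  fixes f g :: "'a \<Rightarrow> real"
  assumes "integrable M f" "g \<in> borel_measurable M" "\<And>x. \<bar>g x\<bar> \<le> C"
  shows "integrable M (\<lambda>x. f x * g x)"
proof (rule Bochner_Integration.integrable_bound)
  show "integrable M (\<lambda>x. C * f x)" using assms(1) by simp
  show "(\<lambda>x. f x * g x) \<in> borel_measurable M" using assms(1,2) by simp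
  show "AE x in M. norm (f x * g x) \<le> norm (C * f x)"
  proof (rule AE_I2)
    fix x
    have "\<bar>f x\<bar> * \<bar>g x\<bar> \<le> \<bar>f x\<bar> * \<bar>C\<bar>"
      by (rule mult_left_mono) (use assms(3)[of x] in auto)
    then show "norm (f x * g x) \<le> norm (C * f x)" by (simp add: abs_mult mult.commute)
  qed
qed

lemma integrable_norm_square_diff:
  fixes f g :: "'a \<Rightarrow> 'b::euclidean_space"
  assumes [measurable]: "f \<in> borel_measurable M" "g \<in> borel_measurable M"
    and "integrable M (\<lambda>x. (norm (f x))\<^sup>2)" "integrable M (\<lambda>x. (norm (g x))\<^sup>2)"
  shows "integrable M (\<lambda>x. (norm (f x - g x))\<^sup>2)"
proof (rule Bochner_Integration.integrable_bound)
  show "integrable M (\<lambda>x. 2 * (norm (f x))\<^sup>2 + 2 * (norm (g x))\<^sup>2)" using assms by simp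
  show "AE x in M. norm ((norm (f x - g x))\<^sup>2) \<le> norm (2 * (norm (f x))\<^sup>2 + 2 * (norm (g x))\<^sup>2)"
  proof (rule AE_I2)
    fix x
    have "(norm (f x - g x))\<^sup>2 \<le> (norm (f x) + norm (g x))\<^sup>2"
      by (intro power_mono norm_triangle_ineq4) simp
    also have "\<dots> \<le> 2 * (norm (f x))\<^sup>2 + 2 * (norm (g x))\<^sup>2"
      using sum_squares_bound[of "norm (f x)" "norm (g x)"] by (simp add: power2_sum)
    finally show "norm ((norm (f x - g x))\<^sup>2) \<le> norm (2 * (norm (f x))\<^sup>2 + 2 * (norm (g x))\<^sup>2)" by simp
  qed
qed measurable

lemma integrable_inner_if_squares:
  fixes f g :: "'a \<Rightarrow> 'b::euclidean_space"
  assumes [measurable]: "f \<in> borel_measurable M" "g \<in> borel_measurable M"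
    and "integrable M (\<lambda>x. (norm (f x))\<^sup>2)" "integrable M (\<lambda>x. (norm (g x))\<^sup>2)"
  shows "integrable M (\<lambda>x. f x \<bullet> g x)"
proof (rule Bochner_Integration.integrable_bound)
  show "integrable M (\<lambda>x. (norm (f x))\<^sup>2 + (norm (g x))\<^sup>2)" using assms by simp
  show "AE x in M. norm (f x \<bullet> g x) \<le> norm ((norm (f x))\<^sup>2 + (norm (g x))\<^sup>2)"
  proof (rule AE_I2)
    fix x
    have "\<bar>f x \<bullet> g x\<bar> \<le> norm (f x) * norm (g x)" by (rule Cauchy_Schwarz_ineq2)
    moreover have "0 \<le> norm (f x) * norm (g x)" by simp
    ultimately have "\<bar>f x \<bullet> g x\<bar> \<le> (norm (f x))\<^sup>2 + (norm (g x))\<^sup>2"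
      using sum_squares_bound[of "norm (f x)" "norm (g x)"] by linarith
    then show "norm (f x \<bullet> g x) \<le> norm ((norm (f x))\<^sup>2 + (norm (g x))\<^sup>2)" by simp
  qed
qed measurable

text \<open>
  Integrate \<open>\<bar>u\<bar> \<le> \<delta> + u\<^sup>2/\<delta>\<close>.
\<close>

lemma (in finite_measure) integral_abs_le_if_square_small:
  fixes u :: "'a \<Rightarrow> real"
  assumes u: "u \<in> borel_measurable M" "integrable M (\<lambda>x. (u x)\<^sup>2)" "(\<integral>x. (u x)\<^sup>2 \<partial>M) \<le> \<delta>\<^sup>2" and "0 < \<delta>"
  shows "(\<integral>x. \<bar>u x\<bar> \<partial>M) \<le> (measure M (space M) + 1) * \<delta>"
proof -
  have pt: "\<bar>u x\<bar> \<le> \<delta> + (u x)\<^sup>2 / \<delta>" for x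
  proof (cases "\<bar>u x\<bar> \<le> \<delta>")
    case True
    moreover have "0 \<le> (u x)\<^sup>2 / \<delta>" using \<open>0 < \<delta>\<close> by simp
    ultimately show ?thesis by linarith
  next
    case False
    then have "\<delta> * \<bar>u x\<bar> \<le> \<bar>u x\<bar> * \<bar>u x\<bar>" by (intro mult_right_mono) auto
    then have "\<bar>u x\<bar> \<le> (u x)\<^sup>2 / \<delta>" using \<open>0 < \<delta>\<close> by (simp add: field_simps power2_eq_square abs_mult_self_eq)
    then show ?thesis using \<open>0 < \<delta>\<close> by linarith
  qed
  have "(\<integral>x. \<bar>u x\<bar> \<partial>M) \<le> (\<integral>x. \<delta> + (u x)\<^sup>2 / \<delta> \<partial>M)"
    using square_integrable_imp_integrable[OF u(1,2)] u(2) pt by (intro integral_mono) auto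
  also have "\<dots> = measure M (space M) * \<delta> + (\<integral>x. (u x)\<^sup>2 \<partial>M) / \<delta>"
    using u(2) by simp
  also have "\<dots> \<le> measure M (space M) * \<delta> + \<delta>\<^sup>2 / \<delta>"
    using u(3) \<open>0 < \<delta>\<close> by (intro add_left_mono divide_right_mono) auto
  finally show ?thesis using \<open>0 < \<delta>\<close> by (simp add: power2_eq_square distrib_right)
qed

lemma abs_diff_le_if_derivative_bounded:
  fixes g :: "real \<Rightarrow> real"
  assumes "\<And>t. (g has_real_derivative g' t) (at t)" "\<And>t. \<bar>g' t\<bar> \<le> M"
  shows "\<bar>g s - g t\<bar> \<le> M * \<bar>s - t\<bar>"
  using field_differentiable_bound[of UNIV g g' M s t] assms by (auto simp: has_field_derivative_at_within)

lemma L2_functions_integrable: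
  assumes "open \<Omega>" "bounded \<Omega>" "u \<in> L2_functions \<Omega>"
  shows "integrable (lebesgue_on \<Omega>) u"
proof -
  interpret finite_measure "lebesgue_on \<Omega>" using assms by (intro finite_measure_lebesgue_on_bounded_open)
  show ?thesis using assms by (auto simp: L2_functions_def intro: square_integrable_imp_integrable)
qed

lemma L2_functions_diff:
  assumes "u \<in> L2_functions \<Omega>" "v \<in> L2_functions \<Omega>"
  shows "(\<lambda>x. u x - v x) \<in> L2_functions \<Omega>"
  using assms integrable_norm_square_diff[of u "lebesgue_on \<Omega>" v] by (auto simp: L2_functions_def)

lemma L2_functions_mult_integrable:
  assumes "u \<in> L2_functions \<Omega>" "v \<in> L2_functions \<Omega>"
  shows "integrable (lebesgue_on \<Omega>) (\<lambda>x. u x * v x)"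
  using assms integrable_inner_if_squares[of u "lebesgue_on \<Omega>" v] by (simp add: L2_functions_def)

lemma L2_functions_Lipschitz:
  assumes \<Omega>: "open \<Omega>" "bounded \<Omega>" and g: "\<And>s t. \<bar>g s - g t\<bar> \<le> M * \<bar>s - t\<bar>" "continuous_on UNIV g"
    and u: "u \<in> L2_functions \<Omega>"
  shows "(\<lambda>x. g (u x)) \<in> L2_functions \<Omega>"
proof -
  interpret finite_measure "lebesgue_on \<Omega>" using \<Omega> by (rule finite_measure_lebesgue_on_bounded_open)
  have u_meas [measurable]: "u \<in> borel_measurable (lebesgue_on \<Omega>)" and u2: "integrable (lebesgue_on \<Omega>) (\<lambda>x. (u x)\<^sup>2)"
    using u by (auto simp: L2_functions_def)
  have [measurable]: "g \<in> borel_measurable borel" by (rule borel_measurable_continuous_onI[OF g(2)])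
  have "integrable (lebesgue_on \<Omega>) (\<lambda>x. (g (u x))\<^sup>2)"
  proof (rule Bochner_Integration.integrable_bound)
    show "integrable (lebesgue_on \<Omega>) (\<lambda>x. 2 * (g 0)\<^sup>2 + 2 * M\<^sup>2 * (u x)\<^sup>2)" using u2 by simp
    show "AE x in lebesgue_on \<Omega>. norm ((g (u x))\<^sup>2) \<le> norm (2 * (g 0)\<^sup>2 + 2 * M\<^sup>2 * (u x)\<^sup>2)"
    proof (rule AE_I2)
      fix x
      have "\<bar>g (u x)\<bar> \<le> \<bar>g 0\<bar> + M * \<bar>u x\<bar>" using g(1)[of "u x" 0] by simp
      then have "(g (u x))\<^sup>2 \<le> (\<bar>g 0\<bar> + M * \<bar>u x\<bar>)\<^sup>2" by (metis abs_ge_zero power2_abs power_mono)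
      also have "\<dots> \<le> 2 * (g 0)\<^sup>2 + 2 * M\<^sup>2 * (u x)\<^sup>2"
        using sum_squares_bound[of "\<bar>g 0\<bar>" "M * \<bar>u x\<bar>"] by (simp add: power2_sum power_mult_distrib)
      finally show "norm ((g (u x))\<^sup>2) \<le> norm (2 * (g 0)\<^sup>2 + 2 * M\<^sup>2 * (u x)\<^sup>2)" by simp
    qed
  qed measurable
  then show ?thesis by (simp add: L2_functions_def)
qed

lemma test_function_bounded:
  assumes "\<psi> \<in> test_functions \<Omega>"
  obtains C where "0 \<le> C" "\<And>x. \<bar>\<psi> x\<bar> \<le> C" "\<And>x i. i \<in> Basis \<Longrightarrow> \<bar>frechet_derivative \<psi> (at x) i\<bar> \<le> C"
proof -
  obtain K where K: "compact K" "\<And>x. x \<notin> K \<Longrightarrow> \<psi> x = 0" "\<And>x. x \<notin> K \<Longrightarrow> gradient \<psi> x = 0"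
    using test_function_support[OF assms] by blast
  have c: "compact (\<psi> ` K)" "compact (gradient \<psi> ` K)"
    using test_function_continuous[OF assms] K(1)
    by (auto intro!: compact_continuous_image intro: continuous_on_subset)
  obtain A where A: "\<And>x. x \<in> K \<Longrightarrow> norm (\<psi> x) \<le> A"
    using compact_imp_bounded[OF c(1)] by (auto simp: bounded_iff)
  obtain B where B: "\<And>x. x \<in> K \<Longrightarrow> norm (gradient \<psi> x) \<le> B"
    using compact_imp_bounded[OF c(2)] by (auto simp: bounded_iff)
  let ?C = "max 0 (max A B)"
  have 1: "\<bar>\<psi> x\<bar> \<le> ?C" for x
    using A[of x] K(2)[of x] by (cases "x \<in> K") (auto simp: le_max_iff_disj)
  have "norm (gradient \<psi> x) \<le> ?C" for x
    using B[of x] K(3)[of x] by (cases "x \<in> K") (auto simp: le_max_iff_disj)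
  then have 2: "\<bar>frechet_derivative \<psi> (at x) i\<bar> \<le> ?C" if "i \<in> Basis" for x i
    using Basis_le_norm[OF that, of "gradient \<psi> x"] gradient_inner[OF that, of \<psi> x] by (metis order_trans)
  show ?thesis by (rule that[of ?C]) (use 1 2 in auto)
qed

lemma test_function_measurable:
  assumes "\<psi> \<in> test_functions \<Omega>"
  shows "\<psi> \<in> borel_measurable (lebesgue_on \<Omega>)" "gradient \<psi> \<in> borel_measurable (lebesgue_on \<Omega>)"
    and "i \<in> Basis \<Longrightarrow> (\<lambda>x. frechet_derivative \<psi> (at x) i) \<in> borel_measurable (lebesgue_on \<Omega>)"
proof -
  note cont = test_function_continuous[OF assms]
  show "\<psi> \<in> borel_measurable (lebesgue_on \<Omega>)"
    by (rule borel_imp_measurable_lebesgue_on[OF borel_measurable_continuous_onI[OF cont(1)]])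
  show *: "gradient \<psi> \<in> borel_measurable (lebesgue_on \<Omega>)"
    by (rule borel_imp_measurable_lebesgue_on[OF borel_measurable_continuous_onI[OF cont(2)]])
  show "(\<lambda>x. frechet_derivative \<psi> (at x) i) \<in> borel_measurable (lebesgue_on \<Omega>)" if "i \<in> Basis"
    using borel_measurable_inner[OF * borel_measurable_const[of i]] by (simp add: gradient_inner[OF that])
qed

lemma test_function_square_integrable:
  assumes "open \<Omega>" "\<phi> \<in> test_functions \<Omega>"
  shows "\<phi> \<in> L2_functions \<Omega>" "integrable (lebesgue_on \<Omega>) (\<lambda>x. (norm (gradient \<phi> x))\<^sup>2)"
proof -
  obtain K where K: "compact K" "K \<subseteq> \<Omega>" "\<And>x. x \<notin> K \<Longrightarrow> \<phi> x = 0" "\<And>x. x \<notin> K \<Longrightarrow> gradient \<phi> x = 0"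
    using test_function_support[OF assms(2)] by blast
  note cont = test_function_continuous[OF assms(2)]
  have "integrable (lebesgue_on \<Omega>) (\<lambda>x. (\<phi> x)\<^sup>2)"
    by (rule integral_lebesgue_on_compact_support(1)[OF _ K(1) _ K(2) assms(1)]) (use K in \<open>auto intro!: continuous_intros cont\<close>)
  then show "\<phi> \<in> L2_functions \<Omega>"
    using test_function_measurable(1)[OF assms(2)] by (simp add: L2_functions_def)
  show "integrable (lebesgue_on \<Omega>) (\<lambda>x. (norm (gradient \<phi> x))\<^sup>2)"
    by (rule integral_lebesgue_on_compact_support(1)[OF _ K(1) _ K(2) assms(1)]) (use K in \<open>auto intro!: continuous_intros cont\<close>)
qed

lemma has_weak_gradient_test_function:
  assumes "open \<Omega>" "\<phi> \<in> test_functions \<Omega>"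
  shows "has_weak_gradient \<Omega> \<phi> (gradient \<phi>)"
  unfolding has_weak_gradient_def
proof (intro conjI ballI)
  show "gradient \<phi> \<in> borel_measurable (lebesgue_on \<Omega>)" by (rule test_function_measurable(2)[OF assms(2)])
  show "integrable (lebesgue_on \<Omega>) (\<lambda>x. (norm (gradient \<phi> x))\<^sup>2)" by (rule test_function_square_integrable(2)[OF assms])
  fix \<psi> i assume "\<psi> \<in> test_functions \<Omega>" "i \<in> (Basis :: 'a set)"
  from integral_by_parts_test[OF assms this, of "\<lambda>t. t" "\<lambda>_. 1"]
  show "(\<integral>x. \<phi> x * frechet_derivative \<psi> (at x) i \<partial>lebesgue_on \<Omega>) = - (\<integral>x. (gradient \<phi> x \<bullet> i) * \<psi> x \<partial>lebesgue_on \<Omega>)"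
    by simp
qed

lemma has_weak_gradient_integrable:
  assumes "open \<Omega>" "bounded \<Omega>" "has_weak_gradient \<Omega> u G"
  shows "integrable (lebesgue_on \<Omega>) (\<lambda>x. norm (G x))" "integrable (lebesgue_on \<Omega>) (\<lambda>x. G x \<bullet> i)"
proof -
  interpret finite_measure "lebesgue_on \<Omega>" using assms(1,2) by (rule finite_measure_lebesgue_on_bounded_open)
  have G [measurable]: "G \<in> borel_measurable (lebesgue_on \<Omega>)" and G2: "integrable (lebesgue_on \<Omega>) (\<lambda>x. (norm (G x))\<^sup>2)"
    using assms(3) by (auto simp: has_weak_gradient_def)
  show *: "integrable (lebesgue_on \<Omega>) (\<lambda>x. norm (G x))"
    by (rule square_integrable_imp_integrable) (use G2 in auto)
  have "integrable (lebesgue_on \<Omega>) G" using integrable_norm_cancel[OF * G] .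
  then show "integrable (lebesgue_on \<Omega>) (\<lambda>x. G x \<bullet> i)" by simp
qed

lemma has_weak_gradient_diff:
  assumes \<Omega>: "open \<Omega>" "bounded \<Omega>" and u: "u \<in> L2_functions \<Omega>" "has_weak_gradient \<Omega> u G"
    and v: "v \<in> L2_functions \<Omega>" "has_weak_gradient \<Omega> v H"
  shows "has_weak_gradient \<Omega> (\<lambda>x. u x - v x) (\<lambda>x. G x - H x)"
  unfolding has_weak_gradient_def
proof (intro conjI ballI)
  show "(\<lambda>x. G x - H x) \<in> borel_measurable (lebesgue_on \<Omega>)"
    using u v by (auto simp: has_weak_gradient_def)
  show "integrable (lebesgue_on \<Omega>) (\<lambda>x. (norm (G x - H x))\<^sup>2)"
    using u v by (intro integrable_norm_square_diff) (auto simp: has_weak_gradient_def)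
  fix \<psi> i assume \<psi>: "\<psi> \<in> test_functions \<Omega>" and i: "i \<in> (Basis :: 'a set)"
  obtain C where C: "0 \<le> C" "\<And>x. \<bar>\<psi> x\<bar> \<le> C" "\<And>x i. i \<in> Basis \<Longrightarrow> \<bar>frechet_derivative \<psi> (at x) i\<bar> \<le> C"
    using test_function_bounded[OF \<psi>] by blast
  note m = test_function_measurable[OF \<psi>]
  note ui = integrable_mult_bounded[OF L2_functions_integrable[OF \<Omega> u(1)] m(3)[OF i] C(3)[OF i]]
  note vi = integrable_mult_bounded[OF L2_functions_integrable[OF \<Omega> v(1)] m(3)[OF i] C(3)[OF i]]
  note Gi = integrable_mult_bounded[OF has_weak_gradient_integrable(2)[OF \<Omega> u(2), of i] m(1) C(2)]
  note Hi = integrable_mult_bounded[OF has_weak_gradient_integrable(2)[OF \<Omega> v(2), of i] m(1) C(2)]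
  show "(\<integral>x. (u x - v x) * frechet_derivative \<psi> (at x) i \<partial>lebesgue_on \<Omega>)
      = - (\<integral>x. ((G x - H x) \<bullet> i) * \<psi> x \<partial>lebesgue_on \<Omega>)"
    using u(2) v(2) \<psi> i
    by (simp add: has_weak_gradient_def left_diff_distrib inner_diff_left Bochner_Integration.integral_diff[OF ui vi]
        Bochner_Integration.integral_diff[OF Gi Hi])
qed

text \<open>
  Each component of the difference of two weak gradients integrates to \<open>0\<close> against all test functions.
\<close>

lemma weak_gradient_unique:
  fixes \<Omega> :: "'a::euclidean_space set"
  assumes \<Omega>: "open \<Omega>" "bounded \<Omega>" and G: "has_weak_gradient \<Omega> u G" and H: "has_weak_gradient \<Omega> u H"
  shows "AE x in lebesgue_on \<Omega>. G x = H x"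
proof -
  have "AE x in lebesgue_on \<Omega>. G x \<bullet> i - H x \<bullet> i = 0" if i: "i \<in> Basis" for i
  proof (rule AE_zero_if_test_integrals_zero[OF \<Omega>(1)])
    note Gi = has_weak_gradient_integrable(2)[OF \<Omega> G, of i]
    note Hi = has_weak_gradient_integrable(2)[OF \<Omega> H, of i]
    show "integrable (lebesgue_on \<Omega>) (\<lambda>x. G x \<bullet> i - H x \<bullet> i)" using Gi Hi by simp
    fix \<psi> assume \<psi>: "\<psi> \<in> test_functions \<Omega>"
    obtain C where C: "\<And>x. \<bar>\<psi> x\<bar> \<le> C" by (rule test_function_bounded[OF \<psi>]) (rule that; assumption)
    note m = test_function_measurable(1)[OF \<psi>]
    have "(\<integral>x. u x * frechet_derivative \<psi> (at x) i \<partial>lebesgue_on \<Omega>) = - (\<integral>x. (G x \<bullet> i) * \<psi> x \<partial>lebesgue_on \<Omega>)"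
      and "(\<integral>x. u x * frechet_derivative \<psi> (at x) i \<partial>lebesgue_on \<Omega>) = - (\<integral>x. (H x \<bullet> i) * \<psi> x \<partial>lebesgue_on \<Omega>)"
      using G H \<psi> i by (simp_all add: has_weak_gradient_def)
    then have "(\<integral>x. (G x \<bullet> i) * \<psi> x \<partial>lebesgue_on \<Omega>) = (\<integral>x. (H x \<bullet> i) * \<psi> x \<partial>lebesgue_on \<Omega>)" by linarith
    then show "(\<integral>x. (G x \<bullet> i - H x \<bullet> i) * \<psi> x \<partial>lebesgue_on \<Omega>) = 0"
      by (simp add: left_diff_distrib Bochner_Integration.integral_diff[OF integrable_mult_bounded[OF Gi m C] integrable_mult_bounded[OF Hi m C]])
  qed
  then have "AE x in lebesgue_on \<Omega>. \<forall>i\<in>Basis. G x \<bullet> i - H x \<bullet> i = 0"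
    by (intro AE_finite_allI finite_Basis)
  then show ?thesis
  proof eventually_elim
    case (elim x)
    show ?case
    proof (rule euclidean_eqI)
      fix b :: 'a assume "b \<in> Basis"
      with elim have "G x \<bullet> b - H x \<bullet> b = 0" by blast
      then show "G x \<bullet> b = H x \<bullet> b" by linarith
    qed
  qed
qed

text \<open>
  This gives the chosen gradient its meaning: up to a null set it is any weak gradient at hand.
\<close>

lemma weak_gradient_eq:
  assumes "open \<Omega>" "bounded \<Omega>" "has_weak_gradient \<Omega> u G"
  shows "has_weak_gradient \<Omega> u (weak_gradient \<Omega> u)" "AE x in lebesgue_on \<Omega>. weak_gradient \<Omega> u x = G x"
proof -
  show *: "has_weak_gradient \<Omega> u (weak_gradient \<Omega> u)"
    unfolding weak_gradient_def by (rule someI[of "has_weak_gradient \<Omega> u", OF assms(3)])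
  show "AE x in lebesgue_on \<Omega>. weak_gradient \<Omega> u x = G x"
    by (rule weak_gradient_unique[OF assms(1,2) * assms(3)])
qed

lemma H1_inner_eq:
  assumes \<Omega>: "open \<Omega>" "bounded \<Omega>" and u: "has_weak_gradient \<Omega> u G" and v: "has_weak_gradient \<Omega> v H"
  shows "H1_inner \<Omega> u v = (\<integral>x. u x * v x \<partial>lebesgue_on \<Omega>) + (\<integral>x. G x \<bullet> H x \<partial>lebesgue_on \<Omega>)"
proof -
  have "(\<integral>x. weak_gradient \<Omega> u x \<bullet> weak_gradient \<Omega> v x \<partial>lebesgue_on \<Omega>) = (\<integral>x. G x \<bullet> H x \<partial>lebesgue_on \<Omega>)"
  proof (rule integral_cong_AE)
    show "AE x in lebesgue_on \<Omega>. weak_gradient \<Omega> u x \<bullet> weak_gradient \<Omega> v x = G x \<bullet> H x"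
      using weak_gradient_eq(2)[OF \<Omega> u] weak_gradient_eq(2)[OF \<Omega> v] by eventually_elim simp
  qed (use weak_gradient_eq(1)[OF \<Omega> u] weak_gradient_eq(1)[OF \<Omega> v] u v in \<open>auto simp: has_weak_gradient_def\<close>)
  then show ?thesis by (simp add: H1_inner_def L2_inner_def)
qed

lemma H1_norm_square:
  assumes \<Omega>: "open \<Omega>" "bounded \<Omega>" and u: "has_weak_gradient \<Omega> u G"
  shows "(H1_norm \<Omega> u)\<^sup>2 = (\<integral>x. (u x)\<^sup>2 \<partial>lebesgue_on \<Omega>) + (\<integral>x. (norm (G x))\<^sup>2 \<partial>lebesgue_on \<Omega>)"
proof -
  have "H1_inner \<Omega> u u = (\<integral>x. (u x)\<^sup>2 \<partial>lebesgue_on \<Omega>) + (\<integral>x. (norm (G x))\<^sup>2 \<partial>lebesgue_on \<Omega>)"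
    unfolding H1_inner_eq[OF \<Omega> u u] dot_square_norm by (simp add: power2_eq_square)
  moreover have "0 \<le> (\<integral>x. (u x)\<^sup>2 \<partial>lebesgue_on \<Omega>) + (\<integral>x. (norm (G x))\<^sup>2 \<partial>lebesgue_on \<Omega>)" by simp
  ultimately show ?thesis by (simp add: H1_norm_def)
qed

section \<open>The chain rule for weak gradients\<close>

lemma tendsto_zero_if_le:
  fixes a :: "nat \<Rightarrow> real"
  assumes "\<And>n. \<bar>a n - l\<bar> \<le> c * e n" "e \<longlonglongrightarrow> 0"
  shows "a \<longlonglongrightarrow> l"
proof (rule LIM_zero_cancel, rule Lim_null_comparison)
  show "\<forall>\<^sub>F n in sequentially. norm (a n - l) \<le> c * e n" using assms(1) by simp
  show "(\<lambda>n. c * e n) \<longlonglongrightarrow> 0" using tendsto_mult_right_zero[OF assms(2)] by simp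
qed

text \<open>
  The difference of \<open>G\<close> and the gradient of a test function \<open>\<phi>\<close> is a weak gradient of \<open>w - \<phi>\<close>, hence by
  uniqueness what the \<open>H\<^sup>1\<close> norm of \<open>w - \<phi>\<close> measures. On a set of finite measure smallness in \<open>L\<^sup>2\<close> gives
  smallness in \<open>L\<^sup>1\<close>, which is all that the chain rule needs; a subsequence also converges pointwise.
\<close>

lemma H10_approximation:
  fixes \<Omega> :: "'a::euclidean_space set"
  assumes \<Omega>: "open \<Omega>" "bounded \<Omega>" and w: "w \<in> H10 \<Omega>" and G: "has_weak_gradient \<Omega> w G"
  shows "\<exists>\<phi>. (\<forall>n. \<phi> n \<in> test_functions \<Omega>) \<and>
    (\<lambda>n. \<integral>x. \<bar>w x - \<phi> n x\<bar> \<partial>lebesgue_on \<Omega>) \<longlonglongrightarrow> 0 \<and>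
    (\<lambda>n. \<integral>x. norm (G x - gradient (\<phi> n) x) \<partial>lebesgue_on \<Omega>) \<longlonglongrightarrow> 0 \<and>
    (AE x in lebesgue_on \<Omega>. (\<lambda>n. \<phi> n x) \<longlonglongrightarrow> w x)"
proof -
  interpret finite_measure "lebesgue_on \<Omega>" using \<Omega> by (rule finite_measure_lebesgue_on_bounded_open)
  have w2: "w \<in> L2_functions \<Omega>" using w by (simp add: H10_def H1_def)
  define \<delta> where "\<delta> = (\<lambda>n. 1 / real (Suc n))"
  have \<delta>: "0 < \<delta> n" for n by (simp add: \<delta>_def)
  have "\<exists>\<phi>\<in>test_functions \<Omega>. H1_norm \<Omega> (\<lambda>x. w x - \<phi> x) < \<delta> n" for n
    using w \<delta>[of n] by (simp add: H10_def)
  then obtain \<phi> where \<phi>: "\<And>n. \<phi> n \<in> test_functions \<Omega>" "\<And>n. H1_norm \<Omega> (\<lambda>x. w x - \<phi> n x) < \<delta> n"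
    by metis
  define c where "c = measure (lebesgue_on \<Omega>) (space (lebesgue_on \<Omega>)) + 1"
  have diff: "(\<lambda>x. w x - \<phi> n x) \<in> L2_functions \<Omega>" for n
    by (rule L2_functions_diff[OF w2 test_function_square_integrable(1)[OF \<Omega>(1) \<phi>(1)]])
  have grad: "has_weak_gradient \<Omega> (\<lambda>x. w x - \<phi> n x) (\<lambda>x. G x - gradient (\<phi> n) x)" for n
    by (rule has_weak_gradient_diff[OF \<Omega> w2 G test_function_square_integrable(1)[OF \<Omega>(1) \<phi>(1)]
          has_weak_gradient_test_function[OF \<Omega>(1) \<phi>(1)]])
  have small: "(\<integral>x. (w x - \<phi> n x)\<^sup>2 \<partial>lebesgue_on \<Omega>) \<le> (\<delta> n)\<^sup>2"
    "(\<integral>x. (norm (G x - gradient (\<phi> n) x))\<^sup>2 \<partial>lebesgue_on \<Omega>) \<le> (\<delta> n)\<^sup>2" for n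
  proof -
    let ?A = "\<integral>x. (w x - \<phi> n x)\<^sup>2 \<partial>lebesgue_on \<Omega>"
    let ?B = "\<integral>x. (norm (G x - gradient (\<phi> n) x))\<^sup>2 \<partial>lebesgue_on \<Omega>"
    have AB: "(H1_norm \<Omega> (\<lambda>x. w x - \<phi> n x))\<^sup>2 = ?A + ?B" by (rule H1_norm_square[OF \<Omega> grad])
    have "0 \<le> ?A" "0 \<le> ?B" by simp_all
    moreover have "0 \<le> H1_norm \<Omega> (\<lambda>x. w x - \<phi> n x)"
      unfolding H1_norm_def H1_inner_eq[OF \<Omega> grad grad] by (intro real_sqrt_ge_zero add_nonneg_nonneg) simp_all
    then have "(H1_norm \<Omega> (\<lambda>x. w x - \<phi> n x))\<^sup>2 \<le> (\<delta> n)\<^sup>2" using \<phi>(2)[of n] by (intro power_mono) auto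
    ultimately show "?A \<le> (\<delta> n)\<^sup>2" "?B \<le> (\<delta> n)\<^sup>2" using AB by linarith+
  qed
  have u_L1: "(\<integral>x. \<bar>w x - \<phi> n x\<bar> \<partial>lebesgue_on \<Omega>) \<le> c * \<delta> n" for n
    unfolding c_def by (rule integral_abs_le_if_square_small) (use diff[of n] small(1)[of n] \<delta> in \<open>auto simp: L2_functions_def\<close>)
  have G_L1: "(\<integral>x. norm (G x - gradient (\<phi> n) x) \<partial>lebesgue_on \<Omega>) \<le> c * \<delta> n" for n
  proof -
    have "(\<integral>x. \<bar>norm (G x - gradient (\<phi> n) x)\<bar> \<partial>lebesgue_on \<Omega>) \<le> c * \<delta> n"
      unfolding c_def
      by (rule integral_abs_le_if_square_small) (use grad[of n] small(2)[of n] \<delta> in \<open>auto simp: has_weak_gradient_def\<close>)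
    then show ?thesis by simp
  qed
  have \<delta>0: "\<delta> \<longlonglongrightarrow> 0" unfolding \<delta>_def by (rule lim_1_over_n[THEN LIMSEQ_Suc])
  have u_lim: "(\<lambda>n. \<integral>x. \<bar>w x - \<phi> n x\<bar> \<partial>lebesgue_on \<Omega>) \<longlonglongrightarrow> 0"
    by (rule tendsto_zero_if_le[OF _ \<delta>0, of _ _ c]) (use u_L1 in simp)
  have G_lim: "(\<lambda>n. \<integral>x. norm (G x - gradient (\<phi> n) x) \<partial>lebesgue_on \<Omega>) \<longlonglongrightarrow> 0"
    by (rule tendsto_zero_if_le[OF _ \<delta>0, of _ _ c]) (use G_L1 in simp)
  have "\<exists>r::nat\<Rightarrow>nat. strict_mono r \<and> (AE x in lebesgue_on \<Omega>. (\<lambda>n. w x - \<phi> (r n) x) \<longlonglongrightarrow> 0)"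
    by (rule tendsto_L1_AE_subseq) (use L2_functions_integrable[OF \<Omega> diff] u_lim in auto)
  then obtain r :: "nat \<Rightarrow> nat" where r: "strict_mono r" "AE x in lebesgue_on \<Omega>. (\<lambda>n. w x - \<phi> (r n) x) \<longlonglongrightarrow> 0"
    by blast
  have ae: "AE x in lebesgue_on \<Omega>. (\<lambda>n. \<phi> (r n) x) \<longlonglongrightarrow> w x"
    using r(2)
  proof eventually_elim
    case (elim x)
    from tendsto_diff[OF tendsto_const[of "w x"] this] show ?case by simp
  qed
  show ?thesis
    using LIMSEQ_subseq_LIMSEQ[OF u_lim r(1)] LIMSEQ_subseq_LIMSEQ[OF G_lim r(1)] \<phi>(1) ae
    by (intro exI[of _ "\<lambda>n. \<phi> (r n)"]) (simp add: o_def)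
qed

text \<open>
  The identity holds for the approximating test functions \<open>\<phi>\<^sub>n\<close>. On the left, \<open>g\<close> is Lipschitz, so
  convergence in \<open>L\<^sup>1\<close> suffices. On the right, \<open>\<nabla>\<phi>\<^sub>n\<close> may be replaced by \<open>G\<close> at a cost controlled by their
  \<open>L\<^sup>1\<close> distance, after which \<open>g'(\<phi>\<^sub>n) \<rightarrow> g'(w)\<close> pointwise and dominated convergence applies.
\<close>

lemma has_weak_gradient_compose:
  fixes \<Omega> :: "'a::euclidean_space set"
  assumes \<Omega>: "open \<Omega>" "bounded \<Omega>" and w: "w \<in> H10 \<Omega>" and G: "has_weak_gradient \<Omega> w G"
    and g: "\<And>t. (g has_real_derivative g' t) (at t)" and g'_cont: "continuous_on UNIV g'"
    and M: "\<And>t. \<bar>g' t\<bar> \<le> M"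
  shows "has_weak_gradient \<Omega> (\<lambda>x. g (w x)) (\<lambda>x. g' (w x) *\<^sub>R G x)"
proof -
  have w2: "w \<in> L2_functions \<Omega>" using w by (simp add: H10_def H1_def)
  then have w_meas [measurable]: "w \<in> borel_measurable (lebesgue_on \<Omega>)" by (simp add: L2_functions_def)
  have G_meas [measurable]: "G \<in> borel_measurable (lebesgue_on \<Omega>)" using G by (simp add: has_weak_gradient_def)
  have g_cont: "continuous_on UNIV g" using g by (meson DERIV_continuous_on has_field_derivative_at_within)
  have [measurable]: "g \<in> borel_measurable borel" "g' \<in> borel_measurable borel"
    using g_cont g'_cont by (auto intro: borel_measurable_continuous_onI)
  have M0: "0 \<le> M" using M[of 0] by simp
  have Lip: "\<bar>g s - g t\<bar> \<le> M * \<bar>s - t\<bar>" for s t by (rule abs_diff_le_if_derivative_bounded[OF g M])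
  show ?thesis
    unfolding has_weak_gradient_def
  proof (intro conjI ballI)
    show "(\<lambda>x. g' (w x) *\<^sub>R G x) \<in> borel_measurable (lebesgue_on \<Omega>)" by measurable
    show "integrable (lebesgue_on \<Omega>) (\<lambda>x. (norm (g' (w x) *\<^sub>R G x))\<^sup>2)"
    proof (rule Bochner_Integration.integrable_bound)
      show "integrable (lebesgue_on \<Omega>) (\<lambda>x. M\<^sup>2 * (norm (G x))\<^sup>2)" using G by (simp add: has_weak_gradient_def)
      show "AE x in lebesgue_on \<Omega>. norm ((norm (g' (w x) *\<^sub>R G x))\<^sup>2) \<le> norm (M\<^sup>2 * (norm (G x))\<^sup>2)"
      proof (rule AE_I2)
        fix x
        have "(g' (w x))\<^sup>2 \<le> M\<^sup>2" using M[of "w x"] by (metis abs_ge_zero power2_abs power_mono)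
        then have "(g' (w x))\<^sup>2 * (norm (G x))\<^sup>2 \<le> M\<^sup>2 * (norm (G x))\<^sup>2" by (rule mult_right_mono) simp
        then show "norm ((norm (g' (w x) *\<^sub>R G x))\<^sup>2) \<le> norm (M\<^sup>2 * (norm (G x))\<^sup>2)"
          by (simp add: power_mult_distrib)
      qed
    qed measurable
    fix \<psi> i assume \<psi>: "\<psi> \<in> test_functions \<Omega>" and i: "i \<in> (Basis :: 'a set)"
    obtain C where C: "0 \<le> C" "\<And>x. \<bar>\<psi> x\<bar> \<le> C" "\<And>x i. i \<in> Basis \<Longrightarrow> \<bar>frechet_derivative \<psi> (at x) i\<bar> \<le> C"
      using test_function_bounded[OF \<psi>] by blast
    obtain \<phi> where \<phi>: "\<And>n. \<phi> n \<in> test_functions \<Omega>"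
      and u_lim: "(\<lambda>n. \<integral>x. \<bar>w x - \<phi> n x\<bar> \<partial>lebesgue_on \<Omega>) \<longlonglongrightarrow> 0"
      and G_lim: "(\<lambda>n. \<integral>x. norm (G x - gradient (\<phi> n) x) \<partial>lebesgue_on \<Omega>) \<longlonglongrightarrow> 0"
      and ae: "AE x in lebesgue_on \<Omega>. (\<lambda>n. \<phi> n x) \<longlonglongrightarrow> w x"
      using H10_approximation[OF \<Omega> w G] by (elim exE conjE) blast
    define D where "D = (\<lambda>x. frechet_derivative \<psi> (at x) i)"
    note \<psi>_meas [measurable] = test_function_measurable(1)[OF \<psi>]
    have D_meas [measurable]: "D \<in> borel_measurable (lebesgue_on \<Omega>)"
      unfolding D_def by (rule test_function_measurable(3)[OF \<psi> i])
    have D_C: "\<bar>D x\<bar> \<le> C" for x unfolding D_def by (rule C(3)[OF i])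
    note \<phi>_meas [measurable] = test_function_measurable(1,2)[OF \<phi>]
    have \<phi>2: "\<phi> n \<in> L2_functions \<Omega>" for n by (rule test_function_square_integrable(1)[OF \<Omega>(1) \<phi>])
    have int_gD: "integrable (lebesgue_on \<Omega>) (\<lambda>x. g (u x) * D x)" if "u \<in> L2_functions \<Omega>" for u
      by (rule integrable_mult_bounded[OF L2_functions_integrable[OF \<Omega> L2_functions_Lipschitz[OF \<Omega> Lip g_cont that]] D_meas D_C])
    have "(\<lambda>n. \<integral>x. g (\<phi> n x) * D x \<partial>lebesgue_on \<Omega>) \<longlonglongrightarrow> (\<integral>x. g (w x) * D x \<partial>lebesgue_on \<Omega>)"
    proof (rule tendsto_zero_if_le[OF _ u_lim])
      fix n
      have "\<bar>(\<integral>x. g (\<phi> n x) * D x \<partial>lebesgue_on \<Omega>) - (\<integral>x. g (w x) * D x \<partial>lebesgue_on \<Omega>)\<bar>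
          = \<bar>\<integral>x. g (\<phi> n x) * D x - g (w x) * D x \<partial>lebesgue_on \<Omega>\<bar>"
        by (simp add: Bochner_Integration.integral_diff[OF int_gD[OF \<phi>2] int_gD[OF w2]])
      also have "\<dots> \<le> (\<integral>x. (M * C) * \<bar>w x - \<phi> n x\<bar> \<partial>lebesgue_on \<Omega>)"
      proof (rule order_trans[OF integral_abs_bound integral_mono])
        show "integrable (lebesgue_on \<Omega>) (\<lambda>x. \<bar>g (\<phi> n x) * D x - g (w x) * D x\<bar>)"
          using int_gD[OF \<phi>2] int_gD[OF w2] by simp
        show "integrable (lebesgue_on \<Omega>) (\<lambda>x. M * C * \<bar>w x - \<phi> n x\<bar>)"
          using L2_functions_integrable[OF \<Omega> L2_functions_diff[OF w2 \<phi>2]] by simp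
        fix x
        have "\<bar>g (\<phi> n x) * D x - g (w x) * D x\<bar> = \<bar>g (\<phi> n x) - g (w x)\<bar> * \<bar>D x\<bar>"
          by (simp flip: left_diff_distrib abs_mult)
        also have "\<dots> \<le> (M * \<bar>\<phi> n x - w x\<bar>) * C" using M0 by (intro mult_mono Lip D_C) auto
        also have "\<dots> = M * C * \<bar>w x - \<phi> n x\<bar>" by (simp add: abs_minus_commute)
        finally show "\<bar>g (\<phi> n x) * D x - g (w x) * D x\<bar> \<le> M * C * \<bar>w x - \<phi> n x\<bar>" .
      qed
      also have "\<dots> = (M * C) * (\<integral>x. \<bar>w x - \<phi> n x\<bar> \<partial>lebesgue_on \<Omega>)" by simp
      finally show "\<bar>(\<integral>x. g (\<phi> n x) * D x \<partial>lebesgue_on \<Omega>) - (\<integral>x. g (w x) * D x \<partial>lebesgue_on \<Omega>)\<bar>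
          \<le> (M * C) * (\<integral>x. \<bar>w x - \<phi> n x\<bar> \<partial>lebesgue_on \<Omega>)" .
    qed
    moreover have "(\<lambda>n. \<integral>x. ((g' (\<phi> n x) *\<^sub>R gradient (\<phi> n) x) \<bullet> i) * \<psi> x \<partial>lebesgue_on \<Omega>)
        \<longlonglongrightarrow> (\<integral>x. ((g' (w x) *\<^sub>R G x) \<bullet> i) * \<psi> x \<partial>lebesgue_on \<Omega>)"
    proof -
      have Gi: "integrable (lebesgue_on \<Omega>) (\<lambda>x. G x \<bullet> i)" by (rule has_weak_gradient_integrable(2)[OF \<Omega> G])
      have bd: "\<bar>g' (u x) * \<psi> x\<bar> \<le> M * C" for u and x :: 'a
        unfolding abs_mult by (intro mult_mono M C M0) simp
      have G_int: "integrable (lebesgue_on \<Omega>) (\<lambda>x. (H x \<bullet> i) * (g' (u x) * \<psi> x))"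
        if "has_weak_gradient \<Omega> v H" "u \<in> borel_measurable (lebesgue_on \<Omega>)" for u v H
      proof (rule integrable_mult_bounded[OF has_weak_gradient_integrable(2)[OF \<Omega> that(1)] _ bd])
        show "(\<lambda>x. g' (u x) * \<psi> x) \<in> borel_measurable (lebesgue_on \<Omega>)" using that(2) by measurable
      qed
      have 1: "(\<lambda>n. \<integral>x. (G x \<bullet> i) * (g' (\<phi> n x) * \<psi> x) \<partial>lebesgue_on \<Omega>)
          \<longlonglongrightarrow> (\<integral>x. (G x \<bullet> i) * (g' (w x) * \<psi> x) \<partial>lebesgue_on \<Omega>)"
      proof (rule integral_dominated_convergence[where w = "\<lambda>x. (M * C) * \<bar>G x \<bullet> i\<bar>"])
        show "integrable (lebesgue_on \<Omega>) (\<lambda>x. (M * C) * \<bar>G x \<bullet> i\<bar>)" using Gi by simp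
        show "AE x in lebesgue_on \<Omega>. (\<lambda>n. (G x \<bullet> i) * (g' (\<phi> n x) * \<psi> x)) \<longlonglongrightarrow> (G x \<bullet> i) * (g' (w x) * \<psi> x)"
          using ae
        proof eventually_elim
          case (elim x)
          have "isCont g' (w x)" using g'_cont by (simp add: continuous_on_eq_continuous_at)
          from isCont_tendsto_compose[OF this elim] show ?case by (intro tendsto_intros)
        qed
        show "AE x in lebesgue_on \<Omega>. norm ((G x \<bullet> i) * (g' (\<phi> n x) * \<psi> x)) \<le> (M * C) * \<bar>G x \<bullet> i\<bar>" for n
        proof (rule AE_I2)
          fix x
          show "norm ((G x \<bullet> i) * (g' (\<phi> n x) * \<psi> x)) \<le> (M * C) * \<bar>G x \<bullet> i\<bar>"
            using mult_right_mono[OF bd[of "\<phi> n" x] abs_ge_zero[of "G x \<bullet> i"]] by (simp add: abs_mult mult_ac)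
        qed
      qed measurable
      have "(\<lambda>n. (\<integral>x. (gradient (\<phi> n) x \<bullet> i) * (g' (\<phi> n x) * \<psi> x) \<partial>lebesgue_on \<Omega>)
          - (\<integral>x. (G x \<bullet> i) * (g' (\<phi> n x) * \<psi> x) \<partial>lebesgue_on \<Omega>)) \<longlonglongrightarrow> 0"
      proof (rule tendsto_zero_if_le[OF _ G_lim])
        fix n
        note grad_n = has_weak_gradient_test_function[OF \<Omega>(1) \<phi>[of n]]
        note I1 = G_int[OF grad_n \<phi>_meas(1)[of n]] and I2 = G_int[OF G \<phi>_meas(1)[of n]]
        have "\<bar>(\<integral>x. (gradient (\<phi> n) x \<bullet> i) * (g' (\<phi> n x) * \<psi> x) \<partial>lebesgue_on \<Omega>)
            - (\<integral>x. (G x \<bullet> i) * (g' (\<phi> n x) * \<psi> x) \<partial>lebesgue_on \<Omega>)\<bar>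
            = \<bar>\<integral>x. (gradient (\<phi> n) x \<bullet> i) * (g' (\<phi> n x) * \<psi> x) - (G x \<bullet> i) * (g' (\<phi> n x) * \<psi> x) \<partial>lebesgue_on \<Omega>\<bar>"
          by (simp only: Bochner_Integration.integral_diff[OF I1 I2])
        also have "\<dots> \<le> (\<integral>x. (M * C) * norm (G x - gradient (\<phi> n) x) \<partial>lebesgue_on \<Omega>)"
        proof (rule order_trans[OF integral_abs_bound integral_mono])
          show "integrable (lebesgue_on \<Omega>) (\<lambda>x. \<bar>(gradient (\<phi> n) x \<bullet> i) * (g' (\<phi> n x) * \<psi> x) - (G x \<bullet> i) * (g' (\<phi> n x) * \<psi> x)\<bar>)"
            using I1 I2 by simp
          show "integrable (lebesgue_on \<Omega>) (\<lambda>x. (M * C) * norm (G x - gradient (\<phi> n) x))"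
            using has_weak_gradient_integrable(1)[OF \<Omega> has_weak_gradient_diff[OF \<Omega> w2 G \<phi>2 grad_n]] by simp
          fix x
          have "\<bar>(gradient (\<phi> n) x \<bullet> i) * (g' (\<phi> n x) * \<psi> x) - (G x \<bullet> i) * (g' (\<phi> n x) * \<psi> x)\<bar>
              = \<bar>(gradient (\<phi> n) x - G x) \<bullet> i\<bar> * \<bar>g' (\<phi> n x) * \<psi> x\<bar>"
            by (simp add: inner_diff_left flip: left_diff_distrib abs_mult)
          also have "\<dots> \<le> norm (G x - gradient (\<phi> n) x) * (M * C)"
            using Basis_le_norm[OF i, of "gradient (\<phi> n) x - G x"] bd by (intro mult_mono) (auto simp: norm_minus_commute)
          finally show "\<bar>(gradient (\<phi> n) x \<bullet> i) * (g' (\<phi> n x) * \<psi> x) - (G x \<bullet> i) * (g' (\<phi> n x) * \<psi> x)\<bar>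
              \<le> (M * C) * norm (G x - gradient (\<phi> n) x)" by (simp add: mult.commute)
        qed
        also have "\<dots> = (M * C) * (\<integral>x. norm (G x - gradient (\<phi> n) x) \<partial>lebesgue_on \<Omega>)" by simp
        finally show "\<bar>(\<integral>x. (gradient (\<phi> n) x \<bullet> i) * (g' (\<phi> n x) * \<psi> x) \<partial>lebesgue_on \<Omega>)
            - (\<integral>x. (G x \<bullet> i) * (g' (\<phi> n x) * \<psi> x) \<partial>lebesgue_on \<Omega>) - 0\<bar>
            \<le> (M * C) * (\<integral>x. norm (G x - gradient (\<phi> n) x) \<partial>lebesgue_on \<Omega>)" by simp
      qed
      from tendsto_add[OF this 1] show ?thesis by (simp add: mult_ac)
    qed
    from tendsto_minus[OF this] have "(\<lambda>n. \<integral>x. g (\<phi> n x) * D x \<partial>lebesgue_on \<Omega>)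
        \<longlonglongrightarrow> - (\<integral>x. ((g' (w x) *\<^sub>R G x) \<bullet> i) * \<psi> x \<partial>lebesgue_on \<Omega>)"
      unfolding D_def integral_by_parts_test[OF \<Omega>(1) \<phi> \<psi> i g g'_cont] .
    ultimately show "(\<integral>x. g (w x) * frechet_derivative \<psi> (at x) i \<partial>lebesgue_on \<Omega>)
        = - (\<integral>x. ((g' (w x) *\<^sub>R G x) \<bullet> i) * \<psi> x \<partial>lebesgue_on \<Omega>)"
      using LIMSEQ_unique unfolding D_def by blast
  qed
qed

section \<open>Dissipativity of Nemytskii operators\<close>

text \<open>
  By the mean value theorem \<open>g s - g t = m (s - t)\<close> for a value \<open>m\<close> of \<open>g'\<close>, and the claim is the bound
  for \<open>m\<close> multiplied by \<open>(s - t)\<^sup>2\<close>.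
\<close>

lemma diff_dissipative_if_derivative:
  fixes g :: "real \<Rightarrow> real"
  assumes g: "\<And>t. (g has_real_derivative g' t) (at t)" and \<kappa>: "\<And>t. g' t + \<tau> * (g' t)\<^sup>2 \<le> \<kappa>"
  shows "(g s - g t) * (s - t) + \<tau> * (g s - g t)\<^sup>2 \<le> \<kappa> * (s - t)\<^sup>2"
proof -
  obtain z where z: "g s - g t = g' z * (s - t)"
  proof (cases s t rule: linorder_cases)
    case less
    then obtain z where "g t - g s = (t - s) * g' z" using MVT2[of s t g g'] g by blast
    then show ?thesis by (intro that[of z]) (simp add: algebra_simps)
  next
    case equal
    then show ?thesis using that by simp
  next
    case greater
    then obtain z where "g s - g t = (s - t) * g' z" using MVT2[of t s g g'] g by blast
    then show ?thesis by (intro that[of z]) (simp add: algebra_simps)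
  qed
  have "(g' z + \<tau> * (g' z)\<^sup>2) * (s - t)\<^sup>2 \<le> \<kappa> * (s - t)\<^sup>2"
    by (rule mult_right_mono[OF \<kappa>]) simp
  then show ?thesis unfolding z by (simp add: power2_eq_square algebra_simps)
qed

lemma L2_norm_square: "(L2_norm \<Omega> u)\<^sup>2 = (\<integral>x. (u x)\<^sup>2 \<partial>lebesgue_on \<Omega>)"
  by (simp add: L2_norm_def L2_inner_def flip: power2_eq_square)

lemma Nemytskii_L2_dissipative:
  fixes \<Omega> :: "'a::euclidean_space set"
  assumes \<Omega>: "open \<Omega>" "bounded \<Omega>"
    and g: "\<And>t. (g has_real_derivative g' t) (at t)" and M: "\<And>t. \<bar>g' t\<bar> \<le> M"
    and \<kappa>: "\<And>t. g' t + \<tau> * (g' t)\<^sup>2 \<le> \<kappa>"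
    and u: "u \<in> L2_functions \<Omega>" and v: "v \<in> L2_functions \<Omega>"
  shows "Nemytskii g u \<in> L2_functions \<Omega>"
    and "L2_inner \<Omega> (\<lambda>x. Nemytskii g u x - Nemytskii g v x) (\<lambda>x. u x - v x)
        + \<tau> * (L2_norm \<Omega> (\<lambda>x. Nemytskii g u x - Nemytskii g v x))\<^sup>2
      \<le> \<kappa> * (L2_norm \<Omega> (\<lambda>x. u x - v x))\<^sup>2"
proof -
  have g_cont: "continuous_on UNIV g" using g by (meson DERIV_continuous_on has_field_derivative_at_within)
  have Lip: "\<bar>g s - g t\<bar> \<le> M * \<bar>s - t\<bar>" for s t by (rule abs_diff_le_if_derivative_bounded[OF g M])
  note gL2 = L2_functions_Lipschitz[OF \<Omega> Lip g_cont]
  show "Nemytskii g u \<in> L2_functions \<Omega>" unfolding Nemytskii_def by (rule gL2[OF u])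
  have d: "(\<lambda>x. u x - v x) \<in> L2_functions \<Omega>" "(\<lambda>x. g (u x) - g (v x)) \<in> L2_functions \<Omega>"
    by (intro L2_functions_diff gL2 u v)+
  have I: "integrable (lebesgue_on \<Omega>) (\<lambda>x. (g (u x) - g (v x)) * (u x - v x))"
    "integrable (lebesgue_on \<Omega>) (\<lambda>x. (g (u x) - g (v x))\<^sup>2)" "integrable (lebesgue_on \<Omega>) (\<lambda>x. (u x - v x)\<^sup>2)"
    using L2_functions_mult_integrable[OF d(2,1)] d by (auto simp: L2_functions_def)
  have "(\<integral>x. (g (u x) - g (v x)) * (u x - v x) + \<tau> * (g (u x) - g (v x))\<^sup>2 \<partial>lebesgue_on \<Omega>)
      \<le> (\<integral>x. \<kappa> * (u x - v x)\<^sup>2 \<partial>lebesgue_on \<Omega>)"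
    by (intro integral_mono diff_dissipative_if_derivative[OF g \<kappa>]) (use I in auto)
  then show "L2_inner \<Omega> (\<lambda>x. Nemytskii g u x - Nemytskii g v x) (\<lambda>x. u x - v x)
        + \<tau> * (L2_norm \<Omega> (\<lambda>x. Nemytskii g u x - Nemytskii g v x))\<^sup>2
      \<le> \<kappa> * (L2_norm \<Omega> (\<lambda>x. u x - v x))\<^sup>2"
    unfolding L2_norm_square using I by (simp add: L2_inner_def Nemytskii_def)
qed

text \<open>
  The two parts of the \<open>H\<^sup>1\<close> product are estimated separately: the pointwise bound with the constant \<open>T\<close>
  handles the functions, the bound for \<open>g'\<close> times \<open>\<bar>\<nabla>w\<bar>\<^sup>2\<close> handles the gradients.
\<close>

lemma Nemytskii_H1_dissipative:
  fixes \<Omega> :: "'a::euclidean_space set"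
  assumes \<Omega>: "open \<Omega>" "bounded \<Omega>"
    and g: "\<And>t. (g has_real_derivative g' t) (at t)" and g'_cont: "continuous_on UNIV g'"
    and M: "\<And>t. \<bar>g' t\<bar> \<le> M"
    and \<kappa>: "\<And>t. g' t + \<tau> * (g' t)\<^sup>2 \<le> \<kappa>"
    and T: "\<And>t. t * g t + \<tau> * (g t)\<^sup>2 \<le> T + \<kappa> * t\<^sup>2"
    and w: "w \<in> H10 \<Omega>"
  shows "Nemytskii g w \<in> H1 \<Omega>"
    and "H1_inner \<Omega> w (Nemytskii g w) + \<tau> * (H1_norm \<Omega> (Nemytskii g w))\<^sup>2
      \<le> T * measure (lebesgue_on \<Omega>) \<Omega> + \<kappa> * (H1_norm \<Omega> w)\<^sup>2"
proof -
  interpret finite_measure "lebesgue_on \<Omega>" using \<Omega> by (rule finite_measure_lebesgue_on_bounded_open)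
  have w2: "w \<in> L2_functions \<Omega>" and "w \<in> H1 \<Omega>" using w by (auto simp: H10_def H1_def)
  then obtain G where G: "has_weak_gradient \<Omega> w G" by (auto simp: H1_def)
  define Fw where "Fw = Nemytskii g w"
  define H where "H = (\<lambda>x. g' (w x) *\<^sub>R G x)"
  have Fw2: "Fw \<in> L2_functions \<Omega>"
    unfolding Fw_def by (rule Nemytskii_L2_dissipative(1)[OF \<Omega> g M \<kappa> w2 w2])
  have H: "has_weak_gradient \<Omega> Fw H"
    unfolding Fw_def H_def Nemytskii_def by (rule has_weak_gradient_compose[OF \<Omega> w G g g'_cont M])
  show "Nemytskii g w \<in> H1 \<Omega>" using Fw2 H by (auto simp: H1_def Fw_def)
  have I: "integrable (lebesgue_on \<Omega>) (\<lambda>x. w x * Fw x)"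
    "integrable (lebesgue_on \<Omega>) (\<lambda>x. (Fw x)\<^sup>2)" "integrable (lebesgue_on \<Omega>) (\<lambda>x. (w x)\<^sup>2)"
    using L2_functions_mult_integrable[OF w2 Fw2] w2 Fw2 by (auto simp: L2_functions_def)
  have J: "integrable (lebesgue_on \<Omega>) (\<lambda>x. G x \<bullet> H x)"
    "integrable (lebesgue_on \<Omega>) (\<lambda>x. (norm (G x))\<^sup>2)" "integrable (lebesgue_on \<Omega>) (\<lambda>x. (norm (H x))\<^sup>2)"
    using G H by (auto simp: has_weak_gradient_def intro!: integrable_inner_if_squares)
  have "(\<integral>x. w x * Fw x + \<tau> * (Fw x)\<^sup>2 \<partial>lebesgue_on \<Omega>) \<le> (\<integral>x. T + \<kappa> * (w x)\<^sup>2 \<partial>lebesgue_on \<Omega>)"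
    by (rule integral_mono) (use I T in \<open>auto simp: Fw_def Nemytskii_def\<close>)
  then have 1: "(\<integral>x. w x * Fw x \<partial>lebesgue_on \<Omega>) + \<tau> * (\<integral>x. (Fw x)\<^sup>2 \<partial>lebesgue_on \<Omega>)
      \<le> T * measure (lebesgue_on \<Omega>) \<Omega> + \<kappa> * (\<integral>x. (w x)\<^sup>2 \<partial>lebesgue_on \<Omega>)"
    using I by (simp add: mult.commute)
  have "(\<integral>x. G x \<bullet> H x + \<tau> * (norm (H x))\<^sup>2 \<partial>lebesgue_on \<Omega>) \<le> (\<integral>x. \<kappa> * (norm (G x))\<^sup>2 \<partial>lebesgue_on \<Omega>)"
  proof (rule integral_mono)
    fix x
    have "G x \<bullet> H x + \<tau> * (norm (H x))\<^sup>2 = (g' (w x) + \<tau> * (g' (w x))\<^sup>2) * (norm (G x))\<^sup>2"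
      by (simp add: H_def dot_square_norm power_mult_distrib distrib_right)
    also have "\<dots> \<le> \<kappa> * (norm (G x))\<^sup>2" by (rule mult_right_mono[OF \<kappa>]) simp
    finally show "G x \<bullet> H x + \<tau> * (norm (H x))\<^sup>2 \<le> \<kappa> * (norm (G x))\<^sup>2" .
  qed (use J in auto)
  then have 2: "(\<integral>x. G x \<bullet> H x \<partial>lebesgue_on \<Omega>) + \<tau> * (\<integral>x. (norm (H x))\<^sup>2 \<partial>lebesgue_on \<Omega>)
      \<le> \<kappa> * (\<integral>x. (norm (G x))\<^sup>2 \<partial>lebesgue_on \<Omega>)"
    using J by simp
  show "H1_inner \<Omega> w (Nemytskii g w) + \<tau> * (H1_norm \<Omega> (Nemytskii g w))\<^sup>2
      \<le> T * measure (lebesgue_on \<Omega>) \<Omega> + \<kappa> * (H1_norm \<Omega> w)\<^sup>2"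
    using 1 2 unfolding Fw_def[symmetric] H1_inner_eq[OF \<Omega> G H] H1_norm_square[OF \<Omega> G] H1_norm_square[OF \<Omega> H]
    by (simp only: distrib_left)
qed

section \<open>The tamed estimates\<close>

theorem lemma3p2:
  fixes \<Omega> :: "(real ^ 'n) set"
    and f :: "real \<Rightarrow> real"
    and q K1 K2 K3 L1 L2 L3 L4 L5 L6 :: real
  assumes dim: "CARD('n) \<in> {1, 2, 3}"
    and dom: "open \<Omega>" "bounded \<Omega>" "piecewise_smooth_boundary \<Omega>"
    and f_C2: "f differentiable_on UNIV" "deriv f differentiable_on UNIV"
      "continuous_on UNIV (deriv (deriv f))"
    and q: "1 \<le> q" "CARD('n) = 3 \<longrightarrow> q \<le> 2"
    and pos: "0 < K2" "0 < L1" "0 < L2" "0 < L3" "0 < L4" "0 < L5" "0 < L6"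
    and dissip: "\<And>\<xi>. \<xi> * f \<xi> \<le> K1 - K2 * rpow \<bar>\<xi>\<bar> (q + 2)"
    and onesided: "\<And>\<xi> \<tau>. \<tau> \<in> {0<..<1} \<Longrightarrow>
      (1 + \<tau> * rpow \<bar>\<xi>\<bar> (2 * q)) * deriv f \<xi> - q * \<tau> * rpow \<bar>\<xi>\<bar> (2 * (q - 1)) * \<xi> * f \<xi>
        \<le> K3 * rpow (1 + \<tau> * rpow \<bar>\<xi>\<bar> (2 * q)) (3 / 2)"
    and growth0: "\<And>\<xi>. \<bar>f \<xi>\<bar> \<le> L1 + L2 * rpow \<bar>\<xi>\<bar> (q + 1)"
    and growth1: "\<And>\<xi>. \<bar>deriv f \<xi>\<bar> \<le> L3 + L4 * rpow \<bar>\<xi>\<bar> q"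
    and growth2: "\<And>\<xi>. \<bar>deriv (deriv f) \<xi>\<bar> \<le> L5 + L6 * rpow \<bar>\<xi>\<bar> (q - 1)"
  shows "\<exists>\<tau>1 T1. 0 < \<tau>1 \<and> \<tau>1 < 1 \<and> 0 < T1 \<and>
    (\<forall>\<tau>\<in>{0<..<\<tau>1}.
       (\<forall>\<xi>. tamed f q \<tau> differentiable (at \<xi>) \<and>
          deriv (tamed f q \<tau>) \<xi> + \<tau> * \<bar>deriv (tamed f q \<tau>) \<xi>\<bar>\<^sup>2 \<le> K3 + K3\<^sup>2 * \<tau>) \<and>
       (\<forall>u\<in>L2_functions \<Omega>. \<forall>v\<in>L2_functions \<Omega>.
          let Fu = Nemytskii (tamed f q \<tau>) u; Fv = Nemytskii (tamed f q \<tau>) v in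
          Fu \<in> L2_functions \<Omega> \<and> Fv \<in> L2_functions \<Omega> \<and>
          L2_inner \<Omega> (\<lambda>x. Fu x - Fv x) (\<lambda>x. u x - v x) + \<tau> * (L2_norm \<Omega> (\<lambda>x. Fu x - Fv x))\<^sup>2
            \<le> (K3 + K3\<^sup>2 * \<tau>) * (L2_norm \<Omega> (\<lambda>x. u x - v x))\<^sup>2) \<and>
       (\<forall>w\<in>H10 \<Omega>.
          let Fw = Nemytskii (tamed f q \<tau>) w in
          Fw \<in> H1 \<Omega> \<and>
          H1_inner \<Omega> w Fw + \<tau> * (H1_norm \<Omega> Fw)\<^sup>2
            \<le> T1 + (K3 + K3\<^sup>2 * \<tau>) * (H1_norm \<Omega> w)\<^sup>2))"
proof -
  define C where "C = L3 + L4 + q * (L1 + L2)"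
  define A where "A = \<bar>K3\<bar>"
  \<comment> \<open>The threshold is \<open>1 / E\<^sup>2\<close>, so that \<open>X \<surd>\<tau> \<le> 1\<close> for every \<open>X \<le> E\<close>: the summand \<open>2\<close> gives
    \<open>\<tau> < 1\<close>, \<open>C + A\<close> the lower bound for the derivative, and the last two the absorption of \<open>\<tau>g\<^sup>2\<close> and \<open>A \<xi>\<^sup>2\<close>.\<close>
  define E where "E = 2 + C + A + 4 * A / K2 + 4 * L2\<^sup>2 / K2"
  define T where "T = \<bar>K1\<bar> + 2 * L1\<^sup>2 + A * (4 * A / K2 + 1)\<^sup>2"
  have nonneg: "0 \<le> C" "0 \<le> A" "0 \<le> 4 * A / K2" "0 \<le> 4 * L2\<^sup>2 / K2" "0 \<le> T"
    using pos q by (auto simp: C_def A_def T_def)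
  have E2: "2 \<le> E" using nonneg by (simp add: E_def)
  have f_der: "(f has_real_derivative deriv f t) (at t)" for t
    using f_C2(1) by (simp add: DERIV_deriv_iff_real_differentiable differentiable_on_def)
  have f_cont: "continuous_on UNIV f" "continuous_on UNIV (deriv f)"
    using f_C2 by (auto intro: differentiable_imp_continuous_on)
  have main: "(\<forall>\<xi>. tamed f q \<tau> differentiable (at \<xi>) \<and>
          deriv (tamed f q \<tau>) \<xi> + \<tau> * \<bar>deriv (tamed f q \<tau>) \<xi>\<bar>\<^sup>2 \<le> K3 + K3\<^sup>2 * \<tau>) \<and>
       (\<forall>u\<in>L2_functions \<Omega>. \<forall>v\<in>L2_functions \<Omega>.
          let Fu = Nemytskii (tamed f q \<tau>) u; Fv = Nemytskii (tamed f q \<tau>) v in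
          Fu \<in> L2_functions \<Omega> \<and> Fv \<in> L2_functions \<Omega> \<and>
          L2_inner \<Omega> (\<lambda>x. Fu x - Fv x) (\<lambda>x. u x - v x) + \<tau> * (L2_norm \<Omega> (\<lambda>x. Fu x - Fv x))\<^sup>2
            \<le> (K3 + K3\<^sup>2 * \<tau>) * (L2_norm \<Omega> (\<lambda>x. u x - v x))\<^sup>2) \<and>
       (\<forall>w\<in>H10 \<Omega>.
          let Fw = Nemytskii (tamed f q \<tau>) w in
          Fw \<in> H1 \<Omega> \<and>
          H1_inner \<Omega> w Fw + \<tau> * (H1_norm \<Omega> Fw)\<^sup>2
            \<le> (T * measure (lebesgue_on \<Omega>) \<Omega> + 1) + (K3 + K3\<^sup>2 * \<tau>) * (H1_norm \<Omega> w)\<^sup>2)"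
    if \<tau>_in: "\<tau> \<in> {0<..<1 / E\<^sup>2}" for \<tau>
  proof -
    define r where "r = sqrt \<tau>"
    have \<tau>0: "0 < \<tau>" and "\<tau> < (1 / E)\<^sup>2" using \<tau>_in by (auto simp: power_one_over)
    then have "r < 1 / E" unfolding r_def using E2 by (intro real_less_lsqrt) auto
    then have rE: "r * E \<le> 1" using E2 by (simp add: field_simps)
    have r0: "0 < r" and r2: "r\<^sup>2 = \<tau>" using \<tau>0 by (auto simp: r_def)
    have small: "r * X \<le> 1" if "X \<le> E" for X
      using mult_left_mono[OF that, of r] r0 rE by linarith
    have r1: "r * 2 \<le> 1" by (rule small[OF E2])
    have "r\<^sup>2 < 1" using r0 r1 by (intro power_less_one_iff[THEN iffD2]) auto
    then have \<tau>1: "\<tau> < 1" by (simp add: r2)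
    define g where "g = tamed f q \<tau>"
    define g' where "g' = tamed_deriv f (deriv f) q \<tau>"
    define \<kappa> where "\<kappa> = K3 + K3\<^sup>2 * \<tau>"
    have g: "(g has_real_derivative g' t) (at t)" for t
      unfolding g_def g'_def using \<tau>0 by (intro has_real_derivative_tamed f_der q(1)) simp
    have g'_cont: "continuous_on UNIV g'"
      unfolding g'_def using \<tau>0 by (intro continuous_on_tamed_deriv f_cont q(1)) simp
    have g'_abs: "\<bar>g' t\<bar> \<le> C / r" for t
      unfolding g'_def C_def r_def
      by (rule abs_tamed_deriv_le[OF q(1) \<tau>0 \<tau>1 _ _ _ _ growth0 growth1]) (use pos in auto)
    have g'_le: "g' t \<le> K3" for t
    proof -
      have "0 < 1 + \<tau> * rpow \<bar>t\<bar> (2 * q)" using \<tau>0 q by (simp add: rpow_def add_pos_nonneg)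
      then show ?thesis
        using onesided[of \<tau> t] \<tau>0 \<tau>1 by (simp add: g'_def tamed_deriv_def rpow_def divide_le_eq)
    qed
    have g'_\<kappa>: "g' t + \<tau> * (g' t)\<^sup>2 \<le> \<kappa>" for t
      unfolding \<kappa>_def
    proof (rule add_square_le_of_bounds[OF less_imp_le[OF \<tau>0] g'_le])
      have "\<bar>K3 + g' t\<bar> \<le> A + C / r" using g'_abs[of t] unfolding A_def by linarith
      then have "\<bar>\<tau> * (K3 + g' t)\<bar> \<le> r\<^sup>2 * (A + C / r)"
        unfolding abs_mult r2[symmetric] by (intro mult_mono) auto
      also have "\<dots> = r * (r * A + C)" using r0 by (simp add: power2_eq_square field_simps)
      also have "\<dots> \<le> r * (A + C)"
        using r0 r1 nonneg by (intro mult_left_mono add_right_mono mult_left_le_one_le) auto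
      also have "\<dots> \<le> 1" by (rule small) (use nonneg in \<open>simp add: E_def\<close>)
      finally show "0 \<le> 1 + \<tau> * (K3 + g' t)" by linarith
    qed
    have g_T: "t * g t + \<tau> * (g t)\<^sup>2 \<le> T + \<kappa> * t\<^sup>2" for t
    proof -
      have s1: "4 * L2\<^sup>2 * sqrt \<tau> \<le> K2"
        using small[of "4 * L2\<^sup>2 / K2"] nonneg pos(1) by (simp add: E_def r_def field_simps)
      have s2: "4 * A * sqrt \<tau> \<le> K2"
        using small[of "4 * A / K2"] nonneg pos(1) by (simp add: E_def r_def field_simps)
      have "t * g t + \<tau> * (g t)\<^sup>2 \<le> T - A * t\<^sup>2"
        unfolding g_def T_def
        by (rule tamed_dissipative[OF q(1) \<tau>0 \<tau>1 _ _ pos(1) dissip growth0 s1 s2 nonneg(2)]) (use pos in auto)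
      moreover have "(- A) * t\<^sup>2 \<le> \<kappa> * t\<^sup>2"
        using \<tau>0 unfolding \<kappa>_def A_def by (intro mult_right_mono) (auto intro: order_trans[of _ K3])
      ultimately show ?thesis by simp
    qed
    have 1: "g differentiable (at \<xi>) \<and> deriv g \<xi> + \<tau> * \<bar>deriv g \<xi>\<bar>\<^sup>2 \<le> \<kappa>" for \<xi>
      using g[of \<xi>] g'_\<kappa>[of \<xi>] by (auto simp: DERIV_imp_deriv real_differentiable_def)
    note 2 = Nemytskii_L2_dissipative[OF dom(1,2) g g'_abs g'_\<kappa>]
    note 3 = Nemytskii_H1_dissipative[OF dom(1,2) g g'_cont g'_abs g'_\<kappa> g_T]
    show ?thesis
      unfolding g_def[symmetric] \<kappa>_def[symmetric] Let_def
    proof (intro conjI allI ballI)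
      fix w assume w: "w \<in> H10 \<Omega>"
      show "Nemytskii g w \<in> H1 \<Omega>" by (rule 3(1)[OF w])
      show "H1_inner \<Omega> w (Nemytskii g w) + \<tau> * (H1_norm \<Omega> (Nemytskii g w))\<^sup>2
          \<le> (T * measure (lebesgue_on \<Omega>) \<Omega> + 1) + \<kappa> * (H1_norm \<Omega> w)\<^sup>2"
        using 3(2)[OF w] by linarith
    qed (use 1 2 in blast)+
  qed
  have "0 < 1 / E\<^sup>2" using E2 by simp
  moreover have "1 / E\<^sup>2 < 1"
  proof -
    have "1 < E\<^sup>2" using E2 by (intro one_less_power) auto
    then show ?thesis by (simp add: divide_less_eq)
  qed
  \<comment> \<open>The summand \<open>1\<close> only makes the constant positive, as \<open>\<Omega>\<close> may be empty.\<close>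
  moreover have "0 < T * measure (lebesgue_on \<Omega>) \<Omega> + 1" using nonneg(5) by (simp add: add_nonneg_pos)
  ultimately show ?thesis using main by blast
qed

end
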